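(* Assume (A1)–(A7) (stated in the context) hold. Set $$\theta=1-\frac{\gamma_g\gamma_{h^*}}{2\|A\|_{\mathrm{op}}^2}\left(\sqrt{1+\frac{4\|A\|_{\mathrm{op}}^2}{\gamma_g\gamma_{h^*}}}-1\right),\qquad\tau=\frac{1-\theta}{\gamma_g\theta},\qquad\sigma=\frac{1-\theta}{\gamma_{h^*}\theta}.$$ Let $(x_0,y_0^* )\in\operatorname{dom}\partial g\times\operatorname{dom}\partial h^*$, let $x_{-1}=x_0$, and let $(x_s,y_s^* )$ be the unique saddle point of the Lagrangian $\mathcal L$. For $K\in\mathbb N$, consider the iterates generated for $k=0,1,2,\dots$ by $$y_{k+1}^*=\operatorname*{arg\,max}_{y^*\in\mathcal Y^*}\Big\{-h^*(y^* )+\langle y^*,A(x_k+\theta(x_k-x_{k-1}))\rangle-\tfrac1\sigma D_{\phi_{\mathcal Y^*}}(y^*,y_k^* )\Big\},$$ $$x_{k+1}=\operatorname*{arg\,min}_{x\in\mathcal X}\Big\{g(x)+\langle y_{k+1}^*,Ax\rangle+\tfrac1\tau D_{\phi_{\mathcal X}}(x,x_k)\Big\}.$$ Define $$T_K=\sum_{k=1}^K\frac1{\theta^{k-1}}=\frac{1-\theta^K}{(1-\theta)\theta^{K-1}},\quad X_K=\frac1{T_K}\sum_{k=1}^K\frac1{\theta^{k-1}}x_k,\quad Y_K^*=\frac1{T_K}\sum_{k=1}^K\frac1{\theta^{k-1}}y_k^*,$$ and, for $(x,y^* )\in\operatorname{dom}g\times\operatorname{dom}h^*$, $$\Delta_k(x,y^*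 )=\tfrac1\tau D_{\phi_{\mathcal X}}(x,x_k)+\tfrac1\sigma D_{\phi_{\mathcal Y^*}}(y^*,y_k^* )+\tfrac\theta\tau D_{\phi_{\mathcal X}}(x_k,x_{k-1})-\theta\langle y^*-y_k^*,A(x_k-x_{k-1})\rangle.$$ Then: (a) For every $(x,y^* )\in\operatorname{dom}g\times\operatorname{dom}h^*$ and every nonnegative integer $k$, $$\mathcal L(x_{k+1},y^* )-\mathcal L(x,y_{k+1}^* )\le\Delta_k(x,y^* )-\Delta_{k+1}(x,y^* )/\theta.$$ (b) For every $(x,y^* )\in\operatorname{dom}g\times\operatorname{dom}h^*$, $$T_K\big(\mathcal L(X_K,y^* )-\mathcal L(x,Y_K^* )\big)\le\Delta_0(x,y^* )-\frac1{\theta^K}\Delta_K(x,y^* ),$$ and for the saddle point, $$\tfrac1\tau D_{\phi_{\mathcal X}}(x_s,x_K)\le\Delta_K(x_s,y_s^* )\le\theta^K\Delta_0(x_s,y_s^* ).$$ (c) The sequences $\{(x_k,y_k^* )\}_{k=1}^{+\infty}$ and $\{(X_K,Y_K^* )\}_{K=1}^{+\infty}$ both converge strongly to the unique saddle point $(x_s,y_s^* )$ of $\mathcal L$.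
   Context: $\mathcal X,\mathcal Y$ are real reflexive Banach spaces with norms $\|\cdot\|_{\mathcal X},\|\cdot\|_{\mathcal Y}$, with duals $\mathcal X^*,\mathcal Y^*$ (dual norms $\|\cdot\|_{\mathcal X^*},\|\cdot\|_{\mathcal Y^*}$) and duality pairing $\langle\cdot,\cdot\rangle$. $A:\mathcal X\to\mathcal Y$ is a bounded linear operator with adjoint $A^*$, and $\|A\|_{\mathrm{op}}=\sup_{\|x\|_{\mathcal X}=1}\|Ax\|_{\mathcal Y}$. $\Gamma_0(\mathcal X)$ denotes the proper, convex, lower semicontinuous functions $\mathcal X\to\mathbb R\cup\{+\infty\}$ (similarly for other spaces). $h^*$ is the convex conjugate of $h$, $\partial$ the subdifferential, $\operatorname{dom}\partial f$ the set of points where $\partial f$ is nonempty. Lagrangian: $\mathcal L(x,y^* )=g(x)+\langle y^*,Ax\rangle-h^*(y^* )$. A saddle point of $\mathcal L$ is $(x_s,y_s^* )\in\mathcal X\times\mathcal Y^*$ with $\mathcal L(x_s,y^* )\le\mathcal L(x_s,y_s^* )\le\mathcal L(x,y_s^* )$ for all $x\in\mathcal X,y^*\in\mathcal Y^*$. Primal problem: $\inf_{x\in\mathcal X}\{g(x)+h(Ax)\}$. A function $f\in\Gamma_0(\mathcal X)$ is essentially smooth if $\operatorname{dom}\partial f\neq\varnothing$, $\operatorname{dom}\partial f=\operatorname{int}(\operatorname{dom}f)$, $f$ is differentiable on $\operatorname{int}(\operatorname{dom}f)$ (there is a continuous linear functional $\nabla f(x)$ giving all one-sided directional derivatives), and $\|\nabla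 f(x_k)\|_{\mathcal X^*}\to+\infty$ for every sequence $(x_k)$ in $\operatorname{int}(\operatorname{dom}f)$ converging to a boundary point of $\operatorname{dom}f$. It is essentially strictly convex if it is strictly convex on every convex subset of $\operatorname{dom}\partial f$ and $\partial f^*$ is locally bounded on its domain. A proper function $f$ is supercoercive if $f(x_k)/\|x_k\|\to+\infty$ whenever $\|x_k\|\to+\infty$. It is $m$-strongly convex if $f(\lambda x+(1-\lambda)x')\le\lambda f(x)+(1-\lambda)f(x')-\frac m2\lambda(1-\lambda)\|x-x'\|^2$ for all $x,x'\in\operatorname{dom}f$, $\lambda\in[0,1]$. These notions apply likewise on $\mathcal Y^*$. Bregman divergences (values in $[0,+\infty]$, second argument in the interior of the domain): $D_{\phi_{\mathcal X}}(x,\bar x)=\phi_{\mathcal X}(x)-\phi_{\mathcal X}(\bar x)-\langle\nabla\phi_{\mathcal X}(\bar x),x-\bar x\rangle$, $D_{\phi_{\mathcal Y^*}}(y^*,\bar y^* )=\phi_{\mathcal Y^*}(y^* )-\phi_{\mathcal Y^*}(\bar y^* )-\langle y^*-\bar y^*,\nabla\phi_{\mathcal Y^*}(\bar y^* )\rangle$. Assumptions. (A1) $g\in\Gamma_0(\mathcal X)$, $h\in\Gamma_0(\mathcal Y)$; the primal problem has at least one solution; and there is $x\in\operatorname{dom}g$ such that $Ax\in\operatorname{dom}h$ and $h$ is continuous at $Ax$. (A2) $\phi_{\mathcal X}\in\Gamma_0(\mathcal X)$ and $\phi_{\mathcal Y^*}\in\Gamma_0(\mathcal Y^* )$ are both essentially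 smooth and essentially strictly convex. (A3) $\operatorname{dom}\partial g\subseteq\operatorname{int}(\operatorname{dom}\phi_{\mathcal X})$, and at least one of $g,\phi_{\mathcal X}$ is supercoercive. (A4) $\operatorname{dom}\partial h^*\subseteq\operatorname{int}(\operatorname{dom}\phi_{\mathcal Y^*})$, and at least one of $h^*,\phi_{\mathcal Y^*}$ is supercoercive. (A5) $\phi_{\mathcal X}$ and $\phi_{\mathcal Y^*}$ are 1-strongly convex with respect to $\|\cdot\|_{\mathcal X}$ and $\|\cdot\|_{\mathcal Y^*}$, respectively, on their domains. (A6) There is $\gamma_g>0$ such that $x\mapsto g(x)-\gamma_g\phi_{\mathcal X}(x)$ is convex. (A7) There is $\gamma_{h^*}>0$ such that $y^*\mapsto h^*(y^* )-\gamma_{h^*}\phi_{\mathcal Y^*}(y^* )$ is convex. Under (A1)–(A4) the iterates are uniquely defined and lie in $\operatorname{dom}\partial g\times\operatorname{dom}\partial h^*$; under (A1), (A6), (A7) the Lagrangian has a unique saddle point. *)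

theory Defs
  imports "HOL-Analysis.Analysis"
begin

text \<open>
  Extended-real-valued functions have type \<open>'a \<Rightarrow> ereal\<close>. The dual of \<open>'a\<close> is \<open>'a \<Rightarrow>\<^sub>L real\<close>, whose
  norm is the dual norm, and the pairing of \<open>p\<close> with \<open>x\<close> is \<open>blinfun_apply p x\<close>. The notions below
  are generic in the space, so they apply to a space as well as to its dual; for a function on
  \<open>'y \<Rightarrow>\<^sub>L real\<close>, subgradients and gradients are elements of the bidual of \<open>'y\<close>.
\<close>

text \<open>The canonical embedding into the bidual is onto.\<close>

definition reflexive_space :: "'a::real_normed_vector itself \<Rightarrow> bool" where
  "reflexive_space _ \<longleftrightarrow>
     (\<forall>F :: ('a \<Rightarrow>\<^sub>L real) \<Rightarrow>\<^sub>L real. \<exists>x :: 'a. \<forall>p. blinfun_apply F p = blinfun_apply p x)"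

definition edom :: "('a \<Rightarrow> ereal) \<Rightarrow> 'a set" where
  "edom f = {x. f x < \<infinity>}"

definition proper_fun :: "('a \<Rightarrow> ereal) \<Rightarrow> bool" where
  "proper_fun f \<longleftrightarrow> (\<forall>x. - \<infinity> < f x) \<and> edom f \<noteq> {}"

text \<open>
  Convexity for extended-real values. In \<open>ereal\<close> we have \<open>\<infinity> + (- \<infinity>) = \<infinity>\<close> and \<open>0 * \<infinity> = 0\<close>, so this
  agrees with convexity of the epigraph also for functions that take the value \<open>- \<infinity>\<close>.
\<close>

definition econvex :: "('a::real_vector \<Rightarrow> ereal) \<Rightarrow> bool" where
  "econvex f \<longleftrightarrow>
     (\<forall>x x'. \<forall>t\<in>{0..1}.
        f (t *\<^sub>R x + (1 - t) *\<^sub>R x') \<le> ereal t * f x + ereal (1 - t) * f x')"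

definition lower_semicont :: "('a::topological_space \<Rightarrow> ereal) \<Rightarrow> bool" where
  "lower_semicont f \<longleftrightarrow> (\<forall>x. f x \<le> Liminf (at x) f)"

definition Gamma0 :: "('a::real_normed_vector \<Rightarrow> ereal) set" where
  "Gamma0 = {f. proper_fun f \<and> econvex f \<and> lower_semicont f}"

definition conjugate :: "('a::real_normed_vector \<Rightarrow> ereal) \<Rightarrow> ('a \<Rightarrow>\<^sub>L real) \<Rightarrow> ereal" where
  "conjugate f p = (SUP x. ereal (blinfun_apply p x) - f x)"

definition subdiff :: "('a::real_normed_vector \<Rightarrow> ereal) \<Rightarrow> 'a \<Rightarrow> ('a \<Rightarrow>\<^sub>L real) set" where
  "subdiff f x = {p. x \<in> edom f \<and> (\<forall>z. f x + ereal (blinfun_apply p (z - x)) \<le> f z)}"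

definition dom_subdiff :: "('a::real_normed_vector \<Rightarrow> ereal) \<Rightarrow> 'a set" where
  "dom_subdiff f = {x. subdiff f x \<noteq> {}}"

text \<open>
  \<open>has_gradient f p x\<close>: the continuous linear functional \<open>p\<close> gives all one-sided directional
  derivatives of \<open>f\<close> at \<open>x\<close>. Since these are finite, \<open>f x\<close> is necessarily finite, and \<open>p\<close> is unique.
\<close>

definition has_gradient ::
    "('a::real_normed_vector \<Rightarrow> ereal) \<Rightarrow> ('a \<Rightarrow>\<^sub>L real) \<Rightarrow> 'a \<Rightarrow> bool" where
  "has_gradient f p x \<longleftrightarrow>
     (\<forall>d. ((\<lambda>t. (f (x + t *\<^sub>R d) - f x) / ereal t) \<longlongrightarrow> ereal (blinfun_apply p d)) (at_right 0))"

definition gradient :: "('a::real_normed_vector \<Rightarrow> ereal) \<Rightarrow> 'a \<Rightarrow> ('a \<Rightarrow>\<^sub>L real)" where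
  "gradient f x = (THE p. has_gradient f p x)"

definition essentially_smooth :: "('a::real_normed_vector \<Rightarrow> ereal) \<Rightarrow> bool" where
  "essentially_smooth f \<longleftrightarrow>
     dom_subdiff f \<noteq> {} \<and>
     dom_subdiff f = interior (edom f) \<and>
     (\<forall>x\<in>interior (edom f). \<exists>p. has_gradient f p x) \<and>
     (\<forall>u z. (\<forall>k. u k \<in> interior (edom f)) \<and> u \<longlonglongrightarrow> z \<and> z \<in> frontier (edom f) \<longrightarrow>
        filterlim (\<lambda>k. norm (gradient f (u k))) at_top sequentially)"

definition locally_bounded_on_dom ::
    "('a::metric_space \<Rightarrow> 'b::metric_space set) \<Rightarrow> bool" where
  "locally_bounded_on_dom M \<longleftrightarrow>
     (\<forall>x. M x \<noteq> {} \<longrightarrow> (\<exists>e>0. bounded (\<Union>z\<in>ball x e. M z)))"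

definition strictly_convex_on :: "'a::real_vector set \<Rightarrow> ('a \<Rightarrow> ereal) \<Rightarrow> bool" where
  "strictly_convex_on C f \<longleftrightarrow>
     (\<forall>x\<in>C. \<forall>x'\<in>C. \<forall>t\<in>{0<..<1}. x \<noteq> x' \<longrightarrow>
        f (t *\<^sub>R x + (1 - t) *\<^sub>R x') < ereal t * f x + ereal (1 - t) * f x')"

text \<open>
  The subdifferential of the conjugate takes values in the bidual, which a reflexive space
  is identified with isometrically.
\<close>

definition essentially_strictly_convex :: "('a::real_normed_vector \<Rightarrow> ereal) \<Rightarrow> bool" where
  "essentially_strictly_convex f \<longleftrightarrow>
     (\<forall>C. convex C \<and> C \<subseteq> dom_subdiff f \<longrightarrow> strictly_convex_on C f) \<and>
     locally_bounded_on_dom (subdiff (conjugate f))"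

definition supercoercive :: "('a::real_normed_vector \<Rightarrow> ereal) \<Rightarrow> bool" where
  "supercoercive f \<longleftrightarrow>
     (\<forall>u :: nat \<Rightarrow> 'a. filterlim (\<lambda>k. norm (u k)) at_top sequentially \<longrightarrow>
        (\<lambda>k. f (u k) / ereal (norm (u k))) \<longlonglongrightarrow> \<infinity>)"

definition strongly_convex :: "real \<Rightarrow> ('a::real_normed_vector \<Rightarrow> ereal) \<Rightarrow> bool" where
  "strongly_convex m f \<longleftrightarrow>
     (\<forall>x\<in>edom f. \<forall>x'\<in>edom f. \<forall>t\<in>{0..1}.
        f (t *\<^sub>R x + (1 - t) *\<^sub>R x') \<le>
          ereal t * f x + ereal (1 - t) * f x' - ereal (m / 2 * t * (1 - t) * (norm (x - x'))\<^sup>2))"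

text \<open>Only meaningful for a second argument in the interior of the domain of \<open>f\<close>.\<close>

definition bregman :: "('a::real_normed_vector \<Rightarrow> ereal) \<Rightarrow> 'a \<Rightarrow> 'a \<Rightarrow> ereal" where
  "bregman f x z = f x - f z - ereal (blinfun_apply (gradient f z) (x - z))"

text \<open>
  When \<open>g x\<close> and \<open>conjugate h p\<close> are both infinite, the value below is \<open>\<infinity>\<close>. The choice
  of convention has no effect on the saddle points when \<open>g\<close> and \<open>conjugate h\<close> are proper.
\<close>

definition lagrangian ::
    "('x::real_normed_vector \<Rightarrow> ereal) \<Rightarrow> ('y::real_normed_vector \<Rightarrow> ereal) \<Rightarrow> ('x \<Rightarrow>\<^sub>L 'y)
      \<Rightarrow> 'x \<Rightarrow> ('y \<Rightarrow>\<^sub>L real) \<Rightarrow> ereal" where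
  "lagrangian g h A x p = g x + ereal (blinfun_apply p (blinfun_apply A x)) - conjugate h p"

definition saddle_point :: "('a \<Rightarrow> 'b \<Rightarrow> ereal) \<Rightarrow> 'a \<Rightarrow> 'b \<Rightarrow> bool" where
  "saddle_point L xs ys \<longleftrightarrow> (\<forall>x y. L xs y \<le> L xs ys \<and> L xs ys \<le> L x ys)"

end

theory Submission
  imports Defs
begin

text \<open>
  Minimality of \<open>x\<^sub>k\<^sub>+\<^sub>1\<close> together with convexity of \<open>g - \<gamma>\<^sub>g \<phi>\<^sub>X\<close> gives a three-point inequality
  with the extra term \<open>\<gamma>\<^sub>g D(u, x\<^sub>k\<^sub>+\<^sub>1)\<close>, and likewise for \<open>y\<^sub>k\<^sub>+\<^sub>1\<close>. Adding the two, the step sizes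
  satisfy \<open>1 / \<tau> + \<gamma>\<^sub>g = 1 / (\<tau> \<theta>)\<close> and \<open>1 / \<sigma> + \<gamma>\<^sub>h = 1 / (\<sigma> \<theta>)\<close>, which produces the factor \<open>1 / \<theta>\<close>
  in front of the new Lyapunov value, and \<open>\<theta> \<sigma> \<tau> \<parallel>A\<parallel>\<^sup>2 = 1\<close>, which makes Young's inequality absorb the
  extrapolation term exactly. The weights \<open>1 / \<theta>\<^sup>k\<close> telescope, and Jensen's inequality passes to
  averages. At the saddle point the Lagrangian gap is nonnegative, so the Lyapunov value decays
  geometrically, and strong convexity turns this into strong convergence.

  No subdifferential sum rule is needed: essential smoothness keeps the minimiser of a proximal step in
  the interior of the domain of the kernel, where its directional derivatives are available.
\<close>

section \<open>Convex functions with extended real values\<close>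

lemma proper_fun_eq_ereal:
  assumes "proper_fun f" "x \<in> edom f"
  shows "f x = ereal (real_of_ereal (f x))"
  using assms by (cases "f x") (auto simp: proper_fun_def edom_def dest: spec[of _ x])

lemma edom_iff_ereal:
  assumes "proper_fun f"
  shows "x \<in> edom f \<longleftrightarrow> (\<exists>r. f x = ereal r)"
  using assms by (cases "f x") (auto simp: proper_fun_def edom_def dest: spec[of _ x])

lemma econvex_imp_convex_on:
  assumes pf: "proper_fun f" and cv: "econvex f"
  shows "convex_on (edom f) (\<lambda>x. real_of_ereal (f x))"
proof (rule convex_onI)
  have *: "(1 - t) *\<^sub>R x + t *\<^sub>R y \<in> edom f \<and>
       real_of_ereal (f ((1 - t) *\<^sub>R x + t *\<^sub>R y)) \<le>
         (1 - t) * real_of_ereal (f x) + t * real_of_ereal (f y)"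
    if t: "0 \<le> t" "t \<le> 1" and xy: "x \<in> edom f" "y \<in> edom f" for t x y
  proof -
    obtain a b where ab: "f x = ereal a" "f y = ereal b"
      using xy edom_iff_ereal[OF pf] by blast
    have "f ((1 - t) *\<^sub>R x + t *\<^sub>R y) \<le> ereal ((1 - t) * a + t * b)"
      using cv[unfolded econvex_def, rule_format, of "1 - t" x y] t ab by simp
    moreover obtain "- \<infinity> < f ((1 - t) *\<^sub>R x + t *\<^sub>R y)"
      using pf by (auto simp: proper_fun_def)
    ultimately show ?thesis
      using ab by (cases "f ((1 - t) *\<^sub>R x + t *\<^sub>R y)") (auto simp: edom_def)
  qed
  show "real_of_ereal (f ((1 - t) *\<^sub>R x + t *\<^sub>R y)) \<le>
         (1 - t) * real_of_ereal (f x) + t * real_of_ereal (f y)"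
    if "0 < t" "t < 1" "x \<in> edom f" "y \<in> edom f" for t x y
    using *[of t x y] that by simp
  show "convex (edom f)"
    unfolding convex_alt using * by (auto simp: algebra_simps)
qed

lemma convex_edom: "proper_fun f \<Longrightarrow> econvex f \<Longrightarrow> convex (edom f)"
  using econvex_imp_convex_on convex_on_imp_convex by blast

text \<open>\<open>Liminf (at x) f\<close> only sees punctured neighbourhoods, and so do limit
  points: if \<open>c < f x\<close>, then all points near \<open>x\<close> other than
  \<open>x\<close> have values above \<open>c\<close>, so \<open>x\<close> is no limit point of the
  sublevel set.\<close>

lemma closed_sublevel:
  assumes "lower_semicont f"
  shows "closed {x. f x \<le> c}"
  unfolding closed_limpt
proof (intro allI impI)
  fix x assume lim: "x islimpt {x. f x \<le> c}"
  show "x \<in> {x. f x \<le> c}"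
  proof (rule ccontr)
    assume "x \<notin> {x. f x \<le> c}"
    then have "c < Liminf (at x) f"
      using assms unfolding lower_semicont_def by (meson linorder_not_le mem_Collect_eq order_less_le_trans)
    then have "\<forall>\<^sub>F z in at x. z \<notin> {x. f x \<le> c}"
      by (auto dest!: less_LiminfD elim: eventually_mono)
    with lim show False by (simp add: islimpt_iff_eventually)
  qed
qed

text \<open>By Baire some sublevel set has interior; convexity carries the bound to every interior point.\<close>

lemma Gamma0_locally_bounded_above:
  fixes f :: "'a::banach \<Rightarrow> ereal"
  assumes f: "f \<in> Gamma0" and z: "z \<in> interior (edom f)"
  obtains r M where "r > 0" "\<And>x. dist z x \<le> r \<Longrightarrow> f x \<le> ereal M"
proof -
  have lsc: "lower_semicont f" and pf: "proper_fun f" and cv: "econvex f"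
    using f by (auto simp: Gamma0_def)
  define S where "S = (\<lambda>n::nat. {x. f x \<le> ereal (real n)})"
  have un: "edom f \<subseteq> \<Union>(range S)"
  proof
    fix x assume "x \<in> edom f"
    then obtain q where "f x = ereal q" using edom_iff_ereal[OF pf] by blast
    moreover obtain n :: nat where "q \<le> real n" using real_arch_simple by blast
    ultimately show "x \<in> \<Union>(range S)" by (auto simp: S_def)
  qed
  obtain n where n: "interior (S n) \<noteq> {}"
  proof (rule ccontr)
    assume "\<not> thesis"
    then have emp: "interior (S n) = {}" for n using that by blast
    have "euclidean interior_of \<Union>(range S) = {}"
      using emp closed_sublevel[OF lsc]
      by (intro Baire_category_alt) (auto simp: completely_metrizable_space_euclidean S_def)
    then show False using z interior_mono[OF un] by auto
  qed
  then obtain c r where r: "r > 0" and c: "ball c r \<subseteq> S n"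
    by (meson ex_in_conv mem_interior)
  obtain e where e: "e > 0" "ball z e \<subseteq> edom f" using z by (meson mem_interior)
  \<comment> \<open>The point \<open>w\<close> lies beyond \<open>z\<close> as seen from
    \<open>c\<close>, so that \<open>z\<close> is a convex combination of \<open>c\<close> and
    \<open>w\<close>. The scale \<open>s\<close> keeps \<open>w\<close> inside
    \<open>ball z e\<close>, and the \<open>+ 1\<close> covers \<open>z = c\<close>.\<close>
  define s where "s = e / (2 * (norm (z - c) + 1))"
  have s: "s > 0" using e by (simp add: s_def add_nonneg_pos)
  define w where "w = z + s *\<^sub>R (z - c)"
  have "norm (s *\<^sub>R (z - c)) \<le> s * (norm (z - c) + 1)" using s by simp
  also have "\<dots> = e / 2"
    using add_nonneg_pos[OF norm_ge_zero[of "z - c"] zero_less_one] by (simp add: s_def field_simps)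
  also have "\<dots> < e" using e by simp
  finally have "w \<in> ball z e" by (simp add: w_def dist_norm)
  then have "w \<in> edom f" using e by blast
  then obtain b where b: "f w = ereal b" using edom_iff_ereal[OF pf] by blast
  define t where "t = s / (1 + s)"
  have t: "t > 0" "t < 1" using s by (auto simp: t_def)
  have zt: "z = t *\<^sub>R c + (1 - t) *\<^sub>R w"
  proof -
    have "1 - t = 1 / (1 + s)" using s by (simp add: t_def field_simps)
    then have "t *\<^sub>R c + (1 - t) *\<^sub>R w = (1 / (1 + s)) *\<^sub>R (s *\<^sub>R c + w)"
      by (simp add: t_def scaleR_add_right)
    also have "s *\<^sub>R c + w = (1 + s) *\<^sub>R z" by (simp add: w_def algebra_simps)
    finally show ?thesis using s by simp
  qed
  show thesis
  proof
    show "t * r / 2 > 0" using t r by simp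
    fix x assume x: "dist z x \<le> t * r / 2"
    \<comment> \<open>The homothety with centre \<open>w\<close> and ratio \<open>t\<close> maps
      \<open>c\<close> to \<open>z\<close> and \<open>v\<close> to \<open>x\<close>. It carries the
      bound on \<open>ball c r\<close> over to a ball around \<open>z\<close>.\<close>
    define v where "v = c + (1 / t) *\<^sub>R (x - z)"
    have "norm ((1 / t) *\<^sub>R (x - z)) = dist z x / t" using t by (simp add: dist_norm norm_minus_commute)
    also have "\<dots> \<le> r / 2" using x t by (simp add: field_simps)
    also have "\<dots> < r" using r by simp
    finally have "v \<in> ball c r" by (simp add: v_def dist_norm)
    then have v: "f v \<le> ereal (real n)" using c by (auto simp: S_def)
    have "t *\<^sub>R v + (1 - t) *\<^sub>R w = (t *\<^sub>R c + (1 - t) *\<^sub>R w) + (x - z)"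
      using t by (simp add: v_def scaleR_add_right)
    also have "\<dots> = x" unfolding zt[symmetric] by simp
    finally have "x = t *\<^sub>R v + (1 - t) *\<^sub>R w" ..
    then have "f x \<le> ereal t * f v + ereal (1 - t) * f w"
      using cv t unfolding econvex_def by auto
    also have "\<dots> \<le> ereal t * ereal (real n) + ereal (1 - t) * f w"
      using v t by (intro add_mono ereal_mult_left_mono) auto
    finally show "f x \<le> ereal (t * real n + (1 - t) * b)" by (simp add: b)
  qed
qed

section \<open>Gradients and Bregman divergences in real arithmetic\<close>

lemma has_gradient_unique:
  assumes "has_gradient f p x" "has_gradient f q x"
  shows "p = q"
proof (rule blinfun_eqI)
  fix d
  show "blinfun_apply p d = blinfun_apply q d"
    using tendsto_unique[OF trivial_limit_at_right_real] assms unfolding has_gradient_def by (metis ereal.inject)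
qed

lemma has_gradient_gradient:
  assumes "has_gradient f p x"
  shows "has_gradient f (gradient f x) x"
  unfolding gradient_def
  using theI[of "\<lambda>p. has_gradient f p x" p] assms has_gradient_unique by blast

lemma eventually_at_right_interior:
  fixes z d :: "'a::real_normed_vector"
  assumes "z \<in> interior S"
  shows "\<forall>\<^sub>F t in at_right 0. z + t *\<^sub>R d \<in> S"
proof -
  have "((\<lambda>t. z + t *\<^sub>R d) \<longlongrightarrow> z + 0 *\<^sub>R d) (at_right 0)" by (intro tendsto_intros)
  then have "\<forall>\<^sub>F t in at_right 0. z + t *\<^sub>R d \<in> interior S"
    by (rule topological_tendstoD) (use assms in simp_all)
  then show ?thesis by (rule eventually_mono) (use interior_subset in blast)
qed

lemma gradient_tendsto_real:
  assumes pf: "proper_fun f" and z: "z \<in> interior (edom f)" and p: "has_gradient f p z"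
  shows "((\<lambda>t. (real_of_ereal (f (z + t *\<^sub>R d)) - real_of_ereal (f z)) / t)
           \<longlongrightarrow> blinfun_apply (gradient f z) d) (at_right 0)"
proof -
  have z': "z \<in> edom f" using z interior_subset by blast
  have "((\<lambda>t. (f (z + t *\<^sub>R d) - f z) / ereal t) \<longlongrightarrow> ereal (blinfun_apply (gradient f z) d)) (at_right 0)"
    using has_gradient_gradient[OF p] unfolding has_gradient_def by blast
  moreover have "\<forall>\<^sub>F t in at_right 0. (f (z + t *\<^sub>R d) - f z) / ereal t =
      ereal ((real_of_ereal (f (z + t *\<^sub>R d)) - real_of_ereal (f z)) / t)"
    using eventually_at_right_interior[OF z, of d] eventually_at_right_less[of 0]
  proof eventually_elim
    case (elim t)
    then obtain a b where "f (z + t *\<^sub>R d) = ereal a" "f z = ereal b"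
      using z' edom_iff_ereal[OF pf] by blast
    then show ?case using elim by simp
  qed
  ultimately have "((\<lambda>t. ereal ((real_of_ereal (f (z + t *\<^sub>R d)) - real_of_ereal (f z)) / t)) \<longlongrightarrow>
      ereal (blinfun_apply (gradient f z) d)) (at_right 0)"
    by (rule Lim_transform_eventually)
  then show ?thesis by simp
qed

definition rbregman :: "('a::real_normed_vector \<Rightarrow> ereal) \<Rightarrow> 'a \<Rightarrow> 'a \<Rightarrow> real" where
  "rbregman f x z =
     real_of_ereal (f x) - real_of_ereal (f z) - blinfun_apply (gradient f z) (x - z)"

lemma bregman_eq_rbregman:
  assumes "proper_fun f" "x \<in> edom f" "z \<in> edom f"
  shows "bregman f x z = ereal (rbregman f x z)"
proof -
  obtain a b where "f x = ereal a" "f z = ereal b" using assms(2,3) edom_iff_ereal[OF assms(1)] by blast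
  then show ?thesis by (simp add: bregman_def rbregman_def)
qed

text \<open>Strong convexity between \<open>x\<close> and \<open>z\<close> bounds the difference
  quotient of \<open>f\<close> at \<open>z\<close> towards \<open>x\<close>; the bound follows as
  the step tends to \<open>0\<close> from the right. The case \<open>m = 0\<close> is the gradient
  inequality.\<close>

lemma rbregman_ge:
  assumes pf: "proper_fun f" and sc: "strongly_convex m f"
    and x: "x \<in> edom f" and z: "z \<in> interior (edom f)" and p: "has_gradient f p z"
  shows "m / 2 * (norm (x - z))\<^sup>2 \<le> rbregman f x z"
proof -
  have z': "z \<in> edom f" using z interior_subset by blast
  define c where "c = m / 2 * (norm (x - z))\<^sup>2"
  obtain a b where ab: "f x = ereal a" "f z = ereal b" using x z' edom_iff_ereal[OF pf] by blast
  have "((\<lambda>t. a - b - (1 - t) * c) \<longlongrightarrow> a - b - (1 - 0) * c) (at_right 0)"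
    by (intro tendsto_intros)
  moreover have "\<forall>\<^sub>F t in at_right 0.
      (real_of_ereal (f (z + t *\<^sub>R (x - z))) - real_of_ereal (f z)) / t \<le> a - b - (1 - t) * c"
    using eventually_at_right_interior[OF z, of "x - z"] eventually_at_right_less[of 0]
      eventually_at_right_real[OF zero_less_one]
  proof eventually_elim
    case (elim t)
    have eq: "z + t *\<^sub>R (x - z) = t *\<^sub>R x + (1 - t) *\<^sub>R z" by (simp add: algebra_simps)
    have "f (z + t *\<^sub>R (x - z)) \<le> ereal (t * a + (1 - t) * b - t * ((1 - t) * c))"
      using sc[unfolded strongly_convex_def, rule_format, OF x z', of t] elim
      by (simp add: eq ab c_def algebra_simps)
    moreover obtain q where "f (z + t *\<^sub>R (x - z)) = ereal q"
      using elim edom_iff_ereal[OF pf] by blast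
    ultimately show ?case using elim by (simp add: ab field_simps)
  qed
  ultimately have "blinfun_apply (gradient f z) (x - z) \<le> a - b - (1 - 0) * c"
    using tendsto_le[OF trivial_limit_at_right_real _ gradient_tendsto_real[OF pf z p]] by blast
  then show ?thesis by (simp add: rbregman_def ab c_def)
qed

section \<open>Essential smoothness and Bregman proximal steps\<close>

lemma econvex_imp_strongly_convex_0:
  assumes "econvex f"
  shows "strongly_convex 0 f"
  using assms by (simp add: econvex_def strongly_convex_def zero_ereal_def[symmetric])

lemma gradient_inequality:
  assumes "proper_fun f" "econvex f" "x \<in> edom f" "z \<in> interior (edom f)" "has_gradient f p z"
  shows "real_of_ereal (f z) + blinfun_apply (gradient f z) (x - z) \<le> real_of_ereal (f x)"
  using rbregman_ge[OF assms(1) econvex_imp_strongly_convex_0 assms(3-5)] assms(2)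
  by (simp add: rbregman_def)

text \<open>The homothety with centre \<open>a\<close> and ratio \<open>t\<close> maps a ball around
  \<open>z\<close> inside \<open>S\<close> onto a ball that convexity keeps inside
  \<open>S\<close>.\<close>

lemma convex_shrink_interior:
  fixes S :: "'a::real_normed_vector set"
  assumes S: "convex S" "a \<in> S" and z: "z \<in> interior S" and t: "0 < t" "t \<le> 1"
  shows "a + t *\<^sub>R (z - a) \<in> interior S"
proof -
  obtain e where e: "e > 0" "ball z e \<subseteq> S" using z by (meson mem_interior)
  have "ball (a + t *\<^sub>R (z - a)) (t * e) \<subseteq> S"
  proof
    fix v assume v: "v \<in> ball (a + t *\<^sub>R (z - a)) (t * e)"
    define d where "d = v - (a + t *\<^sub>R (z - a))"
    have "norm d < t * e" using v by (simp add: d_def dist_norm norm_minus_commute)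
    then have "norm ((1 / t) *\<^sub>R d) < e" using t by (simp add: field_simps)
    then have "z + (1 / t) *\<^sub>R d \<in> S" using e by (auto simp: dist_norm)
    then have "(1 - t) *\<^sub>R a + t *\<^sub>R (z + (1 / t) *\<^sub>R d) \<in> S"
      using S t by (intro convexD_alt) auto
    also have "(1 - t) *\<^sub>R a + t *\<^sub>R (z + (1 / t) *\<^sub>R d) = v"
      using t by (simp add: d_def algebra_simps)
    finally show "v \<in> S" .
  qed
  then show ?thesis unfolding mem_interior using mult_pos_pos[OF t(1) e(1)] by blast
qed

text \<open>
  Testing the gradient inequality at \<open>a + t (z - a)\<close> on a ball around \<open>z\<close> on which \<open>f\<close> is bounded
  shows that the slope of \<open>f\<close> towards \<open>z\<close> tends to \<open>- \<infinity>\<close> at the rate of the norm of the gradient.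
\<close>

lemma essentially_smooth_steep_boundary:
  fixes f :: "'a::banach \<Rightarrow> ereal"
  assumes f: "f \<in> Gamma0" and es: "essentially_smooth f"
    and a: "a \<in> edom f" "a \<notin> interior (edom f)" and z: "z \<in> interior (edom f)"
  obtains t where "0 < t" "t < 1"
    "real_of_ereal (f (a + t *\<^sub>R (z - a))) - real_of_ereal (f a) < B * t"
proof -
  have pf: "proper_fun f" and cv: "econvex f" using f by (auto simp: Gamma0_def)
  let ?r = "\<lambda>x. real_of_ereal (f x)"
  have hg: "\<exists>p. has_gradient f p x" if "x \<in> interior (edom f)" for x
    using es that by (auto simp: essentially_smooth_def)
  have gi: "?r v + blinfun_apply (gradient f v) (x - v) \<le> ?r x"
    if "x \<in> edom f" "v \<in> interior (edom f)" for x v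
    using gradient_inequality[OF pf cv that] hg[OF that(2)] by blast
  obtain r M where r: "r > 0" and M: "\<And>x. dist z x \<le> r \<Longrightarrow> f x \<le> ereal M"
    using Gamma0_locally_bounded_above[OF f z] by blast
  \<comment> \<open>The double \<open>Suc\<close> keeps \<open>t n\<close> strictly below
    \<open>1\<close>. The points \<open>u n\<close> approach \<open>a\<close> along the segment from
    \<open>z\<close>, so essential smoothness makes their gradients blow up.\<close>
  define t where "t = (\<lambda>n. inverse (real (Suc (Suc n))))"
  define u where "u = (\<lambda>n. a + t n *\<^sub>R (z - a))"
  have t: "0 < t n" "t n < 1" for n by (auto simp: t_def field_simps)
  have ui: "u n \<in> interior (edom f)" for n
    unfolding u_def using convex_shrink_interior[OF convex_edom[OF pf cv] a(1) z] t[of n] by simp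
  have "t \<longlonglongrightarrow> 0" unfolding t_def by (rule LIMSEQ_Suc[OF LIMSEQ_inverse_real_of_nat])
  then have "u \<longlonglongrightarrow> a + 0 *\<^sub>R (z - a)" unfolding u_def by (intro tendsto_intros)
  then have "u \<longlonglongrightarrow> a" by simp
  moreover have "a \<in> frontier (edom f)"
    using a closure_subset by (auto simp: frontier_def)
  ultimately have "filterlim (\<lambda>n. norm (gradient f (u n))) at_top sequentially"
    using es ui unfolding essentially_smooth_def by blast
  \<comment> \<open>The tangent at \<open>z\<close> bounds \<open>f\<close> from below along the
    segment, so \<open>C\<close> bounds \<open>M - f (u n)\<close> for every \<open>n\<close>. The
    threshold below then forces the gradient at \<open>u n\<close>, applied to
    \<open>z - u n\<close>, to be at most \<open>- (\<bar>B\<bar> + 1)\<close>.\<close>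
  define C where "C = M - ?r z + norm (gradient f z) * norm (z - a)"
  have "\<forall>\<^sub>F n in sequentially. (C + \<bar>B\<bar> + 1) / r \<le> norm (gradient f (u n))"
    using \<open>filterlim _ at_top sequentially\<close> by (simp add: filterlim_at_top)
  then obtain n where n: "(C + \<bar>B\<bar> + 1) / r \<le> norm (gradient f (u n))"
    by (auto simp: eventually_sequentially)
  define p where "p = gradient f (u n)"
  have uz: "z - u n = (1 - t n) *\<^sub>R (z - a)" by (simp add: u_def algebra_simps)
  have lower: "?r z - norm (gradient f z) * norm (z - a) \<le> ?r (u n)"
  proof -
    have "\<bar>blinfun_apply (gradient f z) (u n - z)\<bar> \<le> norm (gradient f z) * norm (u n - z)"
      using norm_blinfun[of "gradient f z" "u n - z"] by simp
    also have "\<dots> \<le> norm (gradient f z) * norm (z - a)"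
      using uz t[of n] mult_right_mono[of "1 - t n" 1 "norm (z - a)"]
      by (intro mult_left_mono) (auto simp: norm_minus_commute)
    finally show ?thesis using gi[OF _ z, of "u n"] ui[of n] interior_subset by fastforce
  qed
  define q where "q = C - blinfun_apply p (z - u n)"
  have pe: "blinfun_apply p e \<le> q" if "norm e \<le> r" for e
  proof -
    have fe: "f (z + e) \<le> ereal M" using M[of "z + e"] that by (simp add: dist_norm)
    then have "z + e \<in> edom f" by (auto simp: edom_def)
    then have "?r (u n) + blinfun_apply p (z + e - u n) \<le> ?r (z + e)" "f (z + e) = ereal (?r (z + e))"
      using gi[OF _ ui[of n]] proper_fun_eq_ereal[OF pf] by (auto simp: p_def)
    moreover have "?r (z + e) \<le> M" using fe calculation(2) by (metis ereal_less_eq(3))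
    ultimately show ?thesis using lower
      by (simp add: q_def C_def blinfun.diff_right blinfun.add_right)
  qed
  \<comment> \<open>The bound \<open>pe\<close> holds for \<open>e\<close> and for
    \<open>- e\<close>, so it bounds the absolute value of \<open>p\<close> on the ball of radius
    \<open>r\<close>, hence its norm.\<close>
  have "norm p \<le> q / r"
  proof (rule norm_blinfun_bound)
    show "0 \<le> q / r" using pe[of 0] r by simp
    fix x
    show "norm (blinfun_apply p x) \<le> q / r * norm x"
    proof (cases "x = 0")
      case False
      have "blinfun_apply p ((r / norm x) *\<^sub>R x) \<le> q" "blinfun_apply p (- (r / norm x) *\<^sub>R x) \<le> q"
        using False r by (auto intro!: pe)
      then show ?thesis using False r by (auto simp: blinfun.scaleR_right blinfun.minus_right field_simps abs_le_iff)
    qed simp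
  qed
  then have "r * norm p \<le> q" using r by (simp add: field_simps)
  moreover have "C + \<bar>B\<bar> + 1 \<le> r * norm p" using n r by (simp add: p_def field_simps)
  ultimately have le: "(1 - t n) * blinfun_apply p (z - a) \<le> - (\<bar>B\<bar> + 1)"
    by (simp add: q_def uz blinfun.scaleR_right)
  have "blinfun_apply p (z - a) < 0"
    using le t[of n] by (smt (verit) mult_nonneg_nonneg)
  then have "blinfun_apply p (z - a) \<le> (1 - t n) * blinfun_apply p (z - a)"
    using t[of n] by (simp add: algebra_simps mult_le_0_iff)
  then have "blinfun_apply p (z - a) < B" using le by linarith
  then have "t n * blinfun_apply p (z - a) < B * t n" using t[of n] by (simp add: mult.commute)
  \<comment> \<open>The tangent at \<open>u n\<close> is now read back at \<open>a\<close>, which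
    turns the slope bound on \<open>p\<close> into a bound on the decrease of \<open>f\<close> from
    \<open>a\<close> to \<open>u n\<close>.\<close>
  moreover have "?r (u n) + blinfun_apply p (- (t n *\<^sub>R (z - a))) \<le> ?r a"
    using gi[OF a(1) ui[of n]] by (simp add: p_def u_def)
  ultimately have "?r (u n) - ?r a < B * t n"
    by (simp add: blinfun.scaleR_right blinfun.minus_right)
  then show thesis using that[of "t n"] t[of n] by (simp add: u_def)
qed

text \<open>If \<open>g u\<close> is finite and \<open>f u\<close> infinite, the convex function
  \<open>g - \<gamma> f\<close> is \<open>- \<infinity>\<close> at \<open>u\<close>, hence also at
  points of the segment close to \<open>w\<close>. There \<open>f\<close> is finite, so
  \<open>g\<close> would take the value \<open>- \<infinity>\<close>. The inclusion makes the
  Bregman terms finite on \<open>edom g\<close>.\<close>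

lemma edom_subset_of_relative_convex:
  fixes f g :: "'a::real_normed_vector \<Rightarrow> ereal"
  assumes f: "proper_fun f" and g: "proper_fun g"
    and rc: "econvex (\<lambda>u. g u - ereal \<gamma> * f u)" "\<gamma> > 0"
    and w: "w \<in> edom g" "w \<in> interior (edom f)"
  shows "edom g \<subseteq> edom f"
proof
  fix u assume "u \<in> edom g"
  then obtain b where b: "g u = ereal b" using edom_iff_ereal[OF g] by blast
  show "u \<in> edom f"
  proof (rule ccontr)
    assume "u \<notin> edom f"
    then have "f u = \<infinity>" by (simp add: edom_def)
    have "\<forall>\<^sub>F t in at_right 0. w + t *\<^sub>R (u - w) \<in> edom f \<and> t \<in> {0<..<1::real}"
      using eventually_at_right_interior[OF w(2)] eventually_at_right_real[OF zero_less_one]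
      by (rule eventually_conj)
    then obtain t where t: "w + t *\<^sub>R (u - w) \<in> edom f" "0 < t" "t < (1::real)"
      using eventually_happens'[OF trivial_limit_at_right_real] by fastforce
    then obtain q where q: "f (t *\<^sub>R u + (1 - t) *\<^sub>R w) = ereal q"
      using edom_iff_ereal[OF f] by (auto simp: algebra_simps)
    obtain a c where ac: "f w = ereal a" "g w = ereal c"
      using w interior_subset edom_iff_ereal[OF f] edom_iff_ereal[OF g] by blast
    have "g (t *\<^sub>R u + (1 - t) *\<^sub>R w) - ereal \<gamma> * f (t *\<^sub>R u + (1 - t) *\<^sub>R w)
        \<le> ereal t * (g u - ereal \<gamma> * f u) + ereal (1 - t) * (g w - ereal \<gamma> * f w)"
      using rc(1)[unfolded econvex_def, rule_format, of t u w] t by simp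
    also have "\<dots> = - \<infinity>" using t rc(2) by (simp add: b \<open>f u = \<infinity>\<close> ac)
    finally have "g (t *\<^sub>R u + (1 - t) *\<^sub>R w) = - \<infinity>"
      using q by (cases "g (t *\<^sub>R u + (1 - t) *\<^sub>R w)") auto
    then show False using g by (metis less_irrefl proper_fun_def)
  qed
qed

text \<open>One proximal step with kernel \<open>f\<close>, centre \<open>z\<close> and reciprocal
  step size \<open>c\<close>. Both updates of the algorithm are instances: \<open>l\<close> is the
  pairing term, negated for the dual update, and \<open>w\<close> is the starting point.\<close>

locale bregman_prox =
  fixes f g :: "'a::banach \<Rightarrow> ereal" and \<gamma> c :: real and w z :: 'a and l :: "'a \<Rightarrow> real" and p :: 'a
  assumes f: "f \<in> Gamma0" "essentially_smooth f"
    and g: "proper_fun g" "econvex g"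
    and rc: "econvex (\<lambda>u. g u - ereal \<gamma> * f u)" "\<gamma> > 0"
    and w: "w \<in> edom g" "w \<in> interior (edom f)"
    and z: "z \<in> interior (edom f)"
    and l: "linear l"
    and c: "c > 0"
    and minimiser: "is_arg_min (\<lambda>u. g u + ereal (l u) + ereal c * bregman f u z) (\<lambda>_. True) p"
begin

lemma proper_f: "proper_fun f" and convex_f: "econvex f"
  using f by (auto simp: Gamma0_def)

lemma edom_subset: "edom g \<subseteq> edom f"
  by (rule edom_subset_of_relative_convex[OF proper_f g(1) rc w])

lemma z_edom: "z \<in> edom f"
  using z interior_subset by blast

lemma objective_eq:
  assumes "u \<in> edom g"
  shows "g u + ereal (l u) + ereal c * bregman f u z
      = ereal (real_of_ereal (g u) + l u + c * rbregman f u z)"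
proof -
  obtain b where "g u = ereal b" using assms edom_iff_ereal[OF g(1)] by blast
  then show ?thesis
    using bregman_eq_rbregman[OF proper_f _ z_edom] edom_subset assms by auto
qed

lemma minimiser_edom: "p \<in> edom g"
proof (rule ccontr)
  assume "p \<notin> edom g"
  then have gp: "g p = \<infinity>" by (simp add: edom_def)
  obtain b where b: "f z = ereal b" using z_edom edom_iff_ereal[OF proper_f] by blast
  have "- \<infinity> < f p" using proper_f by (simp add: proper_fun_def)
  then have "- \<infinity> < ereal c * bregman f p z"
    using c by (cases "f p") (auto simp: bregman_def b)
  then have "g p + ereal (l p) + ereal c * bregman f p z = \<infinity>" by (simp add: gp)
  moreover have "g w + ereal (l w) + ereal c * bregman f w z < \<infinity>" by (simp add: objective_eq w)
  ultimately show False using minimiser unfolding is_arg_min_def by metis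
qed

lemma real_minimiser:
  assumes "u \<in> edom g"
  shows "real_of_ereal (g p) + l p + c * rbregman f p z \<le> real_of_ereal (g u) + l u + c * rbregman f u z"
  using minimiser objective_eq[OF assms] objective_eq[OF minimiser_edom]
  unfolding is_arg_min_def by (metis ereal_less_eq(3) not_le)

lemma segment_edom:
  assumes "u \<in> edom g" "0 \<le> t" "t \<le> 1"
  shows "p + t *\<^sub>R (u - p) \<in> edom g"
  using convexD_alt[OF convex_edom[OF g] minimiser_edom assms(1), of t] assms
  by (simp add: algebra_simps)

text \<open>When \<open>p\<close> is moved towards \<open>w\<close>, the terms other than
  \<open>f\<close> grow at most linearly in \<open>t\<close>. At a point outside the interior
  \<open>f\<close> would fall faster than any prescribed linear rate, so the objective would
  decrease.\<close>

lemma minimiser_interior: "p \<in> interior (edom f)"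
proof (rule ccontr)
  assume "p \<notin> interior (edom f)"
  \<comment> \<open>Per unit of \<open>t\<close>, \<open>K\<close> bounds the change of all terms of
    the objective except \<open>c f\<close>. The slope \<open>- K / c\<close> for \<open>f\<close>
    therefore outweighs it.\<close>
  define K where "K = real_of_ereal (g w) - real_of_ereal (g p) + l (w - p)
      - c * blinfun_apply (gradient f z) (w - p)"
  obtain t where t: "0 < t" "t < 1"
    "real_of_ereal (f (p + t *\<^sub>R (w - p))) - real_of_ereal (f p) < (- K / c) * t"
    using essentially_smooth_steep_boundary[OF f _ \<open>p \<notin> _\<close> w(2)] minimiser_edom edom_subset by blast
  have "real_of_ereal (g ((1 - t) *\<^sub>R p + t *\<^sub>R w)) \<le> (1 - t) * real_of_ereal (g p) + t * real_of_ereal (g w)"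
    using convex_onD[OF econvex_imp_convex_on[OF g], of t p w] minimiser_edom w t by simp
  then have 1: "real_of_ereal (g (p + t *\<^sub>R (w - p))) \<le> (1 - t) * real_of_ereal (g p) + t * real_of_ereal (g w)"
    by (simp add: algebra_simps)
  have 2: "l (p + t *\<^sub>R (w - p)) = l p + t * l (w - p)"
    using l by (simp add: linear_add linear_scale)
  have 3: "p + t *\<^sub>R (w - p) - z = (p - z) + t *\<^sub>R (w - p)" by simp
  have 4: "c * (real_of_ereal (f (p + t *\<^sub>R (w - p))) - real_of_ereal (f p)) < - K * t"
    using t(3) c by (simp add: field_simps)
  from real_minimiser[OF segment_edom[OF w(1)], of t] t 1 2 4
  show False
    unfolding rbregman_def 3 blinfun.add_right blinfun.scaleR_right K_def
    by (simp add: algebra_simps)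
qed

text \<open>The minimiser is compared with \<open>p + t (u - p)\<close>. Convexity of
  \<open>g - \<gamma> f\<close> bounds the change of \<open>g\<close> by a term linear in
  \<open>t\<close> plus \<open>\<gamma>\<close> times the change of \<open>f\<close>. Only
  \<open>f\<close> is then differentiated, with the total factor
  \<open>c + \<gamma>\<close>.\<close>

lemma three_point:
  assumes u: "u \<in> edom g"
  shows "real_of_ereal (g p) + l p + c * rbregman f p z + (c + \<gamma>) * rbregman f u p
    \<le> real_of_ereal (g u) + l u + c * rbregman f u z"
proof -
  let ?g = "\<lambda>x. real_of_ereal (g x)" and ?f = "\<lambda>x. real_of_ereal (f x)"
  \<comment> \<open>\<open>J\<close> is the coefficient of \<open>t\<close> that remains once
    \<open>(c + \<gamma>)\<close> times the change of \<open>f\<close> is split off.\<close>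
  define J where "J = ?g u - ?g p - \<gamma> * (?f u - ?f p) + l (u - p)
      - c * blinfun_apply (gradient f z) (u - p)"
  obtain q where q: "has_gradient f q p"
    using f(2) minimiser_interior unfolding essentially_smooth_def by blast
  have "0 \<le> J + (c + \<gamma>) * blinfun_apply (gradient f p) (u - p)"
  proof (rule tendsto_lowerbound[OF _ _ trivial_limit_at_right_real])
    show "((\<lambda>t. J + (c + \<gamma>) * ((?f (p + t *\<^sub>R (u - p)) - ?f p) / t)) \<longlongrightarrow>
        J + (c + \<gamma>) * blinfun_apply (gradient f p) (u - p)) (at_right 0)"
      by (intro tendsto_intros gradient_tendsto_real[OF proper_f minimiser_interior q])
    show "\<forall>\<^sub>F t in at_right 0. 0 \<le> J + (c + \<gamma>) * ((?f (p + t *\<^sub>R (u - p)) - ?f p) / t)"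
      using eventually_at_right_real[OF zero_less_one]
    proof eventually_elim
      case (elim t)
      then have t: "0 < t" "t < 1" by auto
      let ?v = "p + t *\<^sub>R (u - p)"
      have v: "?v = t *\<^sub>R u + (1 - t) *\<^sub>R p" by (simp add: algebra_simps)
      have vg: "?v \<in> edom g" using segment_edom[OF u] t by simp
      obtain a1 a2 a3 where a: "f u = ereal a1" "f p = ereal a2" "f ?v = ereal a3"
        using u minimiser_edom vg edom_subset edom_iff_ereal[OF proper_f] by blast
      obtain b1 b2 b3 where b: "g u = ereal b1" "g p = ereal b2" "g ?v = ereal b3"
        using u minimiser_edom vg edom_iff_ereal[OF g(1)] by blast
      have 1: "?g ?v - \<gamma> * ?f ?v \<le> t * (?g u - \<gamma> * ?f u) + (1 - t) * (?g p - \<gamma> * ?f p)"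
        using rc(1)[unfolded econvex_def, rule_format, of t u p] t a b by (simp add: v)
      have 2: "l ?v = l p + t * l (u - p)"
        using l by (simp add: linear_add linear_scale)
      have 3: "?v - z = (p - z) + t *\<^sub>R (u - p)" by simp
      have "0 \<le> t * J + (c + \<gamma>) * (?f ?v - ?f p)"
        using real_minimiser[OF vg] 1
        unfolding rbregman_def 2 3 blinfun.add_right blinfun.scaleR_right J_def
        by (simp add: algebra_simps)
      then have "0 \<le> (t * J + (c + \<gamma>) * (?f ?v - ?f p)) / t" using t by simp
      also have "\<dots> = J + (c + \<gamma>) * ((?f ?v - ?f p) / t)" using t by (simp add: field_simps)
      finally show ?case .
    qed
  qed
  then show ?thesis
    unfolding rbregman_def J_def linear_diff[OF l] blinfun.diff_right
    by (simp add: algebra_simps)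
qed

end

section \<open>The primal-dual iteration\<close>

lemma proper_conjugate:
  assumes "proper_fun h" "edom (conjugate h) \<noteq> {}"
  shows "proper_fun (conjugate h)"
  unfolding proper_fun_def
proof (intro conjI allI)
  fix p
  obtain x a where "h x = ereal a"
    using assms(1) edom_iff_ereal[OF assms(1)] by (auto simp: proper_fun_def)
  then have "ereal (blinfun_apply p x - a) \<le> conjugate h p"
    unfolding conjugate_def by (intro SUP_upper2[of x]) auto
  then show "- \<infinity> < conjugate h p" by (cases "conjugate h p") auto
qed (rule assms(2))

text \<open>A supremum of affine functions is convex; points outside \<open>edom h\<close>
  contribute only \<open>- \<infinity>\<close>.\<close>

lemma econvex_conjugate:
  assumes "proper_fun h"
  shows "econvex (conjugate h)"
  unfolding econvex_def
proof (intro allI ballI)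
  fix p q :: "'a \<Rightarrow>\<^sub>L real" and t :: real
  assume t: "t \<in> {0..1}"
  show "conjugate h (t *\<^sub>R p + (1 - t) *\<^sub>R q) \<le> ereal t * conjugate h p + ereal (1 - t) * conjugate h q"
    unfolding conjugate_def[of h "t *\<^sub>R p + (1 - t) *\<^sub>R q"]
  proof (rule SUP_least)
    fix x
    show "ereal (blinfun_apply (t *\<^sub>R p + (1 - t) *\<^sub>R q) x) - h x
        \<le> ereal t * conjugate h p + ereal (1 - t) * conjugate h q"
    proof (cases "x \<in> edom h")
      case True
      then obtain a where a: "h x = ereal a" using edom_iff_ereal[OF assms] by blast
      have le: "ereal (blinfun_apply r x - a) \<le> conjugate h r" for r
        unfolding conjugate_def using a by (intro SUP_upper2[of x]) auto
      have "ereal (blinfun_apply (t *\<^sub>R p + (1 - t) *\<^sub>R q) x) - h x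
          = ereal t * ereal (blinfun_apply p x - a) + ereal (1 - t) * ereal (blinfun_apply q x - a)"
        by (simp add: a blinfun.add_left blinfun.diff_left blinfun.scaleR_left algebra_simps)
      also have "\<dots> \<le> ereal t * conjugate h p + ereal (1 - t) * conjugate h q"
        using t by (intro add_mono ereal_mult_left_mono le) auto
      finally show ?thesis .
    qed (simp add: edom_def)
  qed
qed

text \<open>The Toeplitz argument: up to a fixed index the weighted distances add up to a constant
  \<open>s\<close>, which is negligible against the diverging total weight. Beyond that index each
  distance is below \<open>e / 2\<close>.\<close>

lemma weighted_average_tendsto:
  fixes x :: "nat \<Rightarrow> 'a::real_normed_vector" and w :: "nat \<Rightarrow> real"
  assumes w: "\<And>k. 0 \<le> w k" and T: "filterlim (\<lambda>K. \<Sum>k=1..K. w k) at_top sequentially"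
    and x: "x \<longlonglongrightarrow> l"
  shows "(\<lambda>K. (1 / (\<Sum>k=1..K. w k)) *\<^sub>R (\<Sum>k=1..K. w k *\<^sub>R x k)) \<longlonglongrightarrow> l"
proof (rule tendstoI)
  fix e :: real assume e: "e > 0"
  let ?T = "\<lambda>K. \<Sum>k=1..K. w k"
  obtain N where N: "\<And>k. k \<ge> N \<Longrightarrow> dist (x k) l < e / 2"
    using x e unfolding lim_sequentially by (meson half_gt_zero)
  define s where "s = (\<Sum>k=1..N. w k * dist (x k) l)"
  have sN: "(\<Sum>k=1..K. w k * dist (x k) l) \<le> s + e / 2 * ?T K" if "K \<ge> N" for K
    using that
  proof (induction K rule: dec_induct)
    case base
    show ?case using w e by (simp add: s_def sum_nonneg)
  next
    case (step K)
    have "w (Suc K) * dist (x (Suc K)) l \<le> w (Suc K) * (e / 2)"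
      using N[of "Suc K"] step w by (intro mult_left_mono) auto
    then show ?case using step.IH by (simp add: algebra_simps)
  qed
  have "\<forall>\<^sub>F K in sequentially. max 0 (2 * s / e) < ?T K"
    using T by (simp only: filterlim_at_top_dense)
  then show "\<forall>\<^sub>F K in sequentially. dist ((1 / ?T K) *\<^sub>R (\<Sum>k=1..K. w k *\<^sub>R x k)) l < e"
    using eventually_ge_at_top[of N]
  proof eventually_elim
    case (elim K)
    then have TK: "?T K > 0" "2 * s < e * ?T K" using e by (auto simp: field_simps)
    have "(1 / ?T K) *\<^sub>R (\<Sum>k=1..K. w k *\<^sub>R x k) - l
        = (1 / ?T K) *\<^sub>R ((\<Sum>k=1..K. w k *\<^sub>R x k) - ?T K *\<^sub>R l)"
      using TK(1) by (simp add: scaleR_diff_right)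
    also have "\<dots> = (1 / ?T K) *\<^sub>R (\<Sum>k=1..K. w k *\<^sub>R (x k - l))"
      by (simp add: scaleR_diff_right sum_subtractf scaleR_sum_left)
    finally have "dist ((1 / ?T K) *\<^sub>R (\<Sum>k=1..K. w k *\<^sub>R x k)) l
        = norm (\<Sum>k=1..K. w k *\<^sub>R (x k - l)) / ?T K"
      using TK(1) by (simp add: dist_norm)
    also have "\<dots> \<le> (\<Sum>k=1..K. w k * dist (x k) l) / ?T K"
      using TK(1) w by (intro divide_right_mono sum_norm_le) (auto simp: dist_norm)
    also have "\<dots> \<le> (s + e / 2 * ?T K) / ?T K"
      using TK(1) sN[OF elim(2)] by (intro divide_right_mono) auto
    also have "\<dots> < e" using TK by (simp add: field_simps)
    finally show ?case .
  qed
qed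

lemma tendsto_of_sq_norm:
  fixes z :: "nat \<Rightarrow> 'b::real_normed_vector"
  assumes "\<And>k. (norm (l - z k))\<^sup>2 \<le> b k" "b \<longlonglongrightarrow> 0"
  shows "z \<longlonglongrightarrow> l"
proof -
  have "(\<lambda>k. (norm (l - z k))\<^sup>2) \<longlonglongrightarrow> 0"
    by (rule tendsto_sandwich[OF _ _ tendsto_const assms(2)]) (use assms(1) in auto)
  then have "(\<lambda>k. sqrt ((norm (l - z k))\<^sup>2)) \<longlonglongrightarrow> sqrt 0" by (rule tendsto_real_sqrt)
  then have "(\<lambda>k. norm (z k - l)) \<longlonglongrightarrow> 0" by (simp add: norm_minus_commute)
  then show ?thesis by (rule LIM_zero_cancel[OF tendsto_norm_zero_cancel])
qed

text \<open>The number \<open>\<theta>\<close> is the smaller root of the quadratic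
  \<open>(1 - \<theta>)\<^sup>2 = s * \<theta>\<close>, whose roots have product \<open>1\<close>.
  The formula gives \<open>\<theta> < 1\<close> directly, and positivity is then read off the
  equation.\<close>

lemma rate_equation:
  fixes s \<theta> :: real
  assumes s: "s > 0" and \<theta>: "\<theta> = 1 - s / 2 * (sqrt (1 + 4 / s) - 1)"
  shows "0 < \<theta>" "\<theta> < 1" "(1 - \<theta>)\<^sup>2 = s * \<theta>"
proof -
  define q where "q = sqrt (1 + 4 / s)"
  have q: "q > 1" and q2: "q\<^sup>2 = 1 + 4 / s" using s by (auto simp: q_def)
  have t: "\<theta> = 1 - s / 2 * (q - 1)" using \<theta> by (simp add: q_def)
  have sq: "s * q\<^sup>2 = s + 4" using q2 s by (simp add: field_simps)
  have "(1 - \<theta>)\<^sup>2 = s / 4 * (s * q\<^sup>2 - 2 * s * q + s)"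
    by (simp add: t power2_eq_square field_simps)
  then show eq: "(1 - \<theta>)\<^sup>2 = s * \<theta>"
    unfolding sq by (simp add: t field_simps)
  show "\<theta> < 1" using q s by (simp add: t)
  then have "s * \<theta> > 0" using eq by (metis diff_gt_0_iff_gt zero_less_power)
  then show "0 < \<theta>" using s by (simp add: zero_less_mult_iff)
qed

text \<open>The algorithm reduced to real arithmetic on the effective domains: two three-point
  inequalities, quadratic lower bounds for the divergences and the step-size identity. At
  \<open>k = 0\<close> the natural number \<open>k - 1\<close> is \<open>0\<close>, so the first
  extrapolation term vanishes.\<close>

locale primal_dual_iteration =
  fixes A :: "'x::real_normed_vector \<Rightarrow>\<^sub>L 'y::real_normed_vector"
    and C :: "'x set" and V :: "('y \<Rightarrow>\<^sub>L real) set"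
    and G :: "'x \<Rightarrow> real" and H :: "('y \<Rightarrow>\<^sub>L real) \<Rightarrow> real"
    and DX :: "'x \<Rightarrow> 'x \<Rightarrow> real" and DY :: "('y \<Rightarrow>\<^sub>L real) \<Rightarrow> ('y \<Rightarrow>\<^sub>L real) \<Rightarrow> real"
    and \<theta> \<tau> \<sigma> :: real
    and x :: "nat \<Rightarrow> 'x" and y :: "nat \<Rightarrow> ('y \<Rightarrow>\<^sub>L real)"
  assumes G: "convex_on C G" and H: "convex_on V H"
    and \<theta>: "0 < \<theta>" "\<theta> < 1" and \<tau>: "0 < \<tau>" and \<sigma>: "0 < \<sigma>"
    and step_size: "\<theta> * \<sigma> * \<tau> * (norm A)\<^sup>2 = 1"
    and x: "\<And>k. x k \<in> C" and y: "\<And>k. y k \<in> V"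
    and DX: "\<And>u k. u \<in> C \<Longrightarrow> (norm (u - x k))\<^sup>2 / 2 \<le> DX u (x k)"
    and DY: "\<And>v k. v \<in> V \<Longrightarrow> (norm (v - y k))\<^sup>2 / 2 \<le> DY v (y k)"
    and x_step: "\<And>u k. u \<in> C \<Longrightarrow>
      G (x (Suc k)) + blinfun_apply (y (Suc k)) (blinfun_apply A (x (Suc k)))
        + 1 / \<tau> * DX (x (Suc k)) (x k) + 1 / \<tau> / \<theta> * DX u (x (Suc k))
      \<le> G u + blinfun_apply (y (Suc k)) (blinfun_apply A u) + 1 / \<tau> * DX u (x k)"
    and y_step: "\<And>v k. v \<in> V \<Longrightarrow>
      H (y (Suc k)) - blinfun_apply (y (Suc k)) (blinfun_apply A (x k + \<theta> *\<^sub>R (x k - x (k - 1))))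
        + 1 / \<sigma> * DY (y (Suc k)) (y k) + 1 / \<sigma> / \<theta> * DY v (y (Suc k))
      \<le> H v - blinfun_apply v (blinfun_apply A (x k + \<theta> *\<^sub>R (x k - x (k - 1)))) + 1 / \<sigma> * DY v (y k)"
begin

definition Lag :: "'x \<Rightarrow> ('y \<Rightarrow>\<^sub>L real) \<Rightarrow> real" where
  "Lag u v = G u + blinfun_apply v (blinfun_apply A u) - H v"

definition Lyap :: "nat \<Rightarrow> 'x \<Rightarrow> ('y \<Rightarrow>\<^sub>L real) \<Rightarrow> real" where
  "Lyap k u v = 1 / \<tau> * DX u (x k) + 1 / \<sigma> * DY v (y k) + \<theta> / \<tau> * DX (x k) (x (k - 1))
     - \<theta> * blinfun_apply (v - y k) (blinfun_apply A (x k - x (k - 1)))"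

lemma pairing_le: "blinfun_apply v (blinfun_apply A u) \<le> norm A * norm u * norm v"
proof -
  have "blinfun_apply v (blinfun_apply A u) \<le> norm v * norm (blinfun_apply A u)"
    using norm_blinfun[of v "blinfun_apply A u"] by simp
  also have "\<dots> \<le> norm v * (norm A * norm u)"
    by (intro mult_left_mono norm_blinfun) auto
  finally show ?thesis by (simp add: mult_ac)
qed

lemma young:
  "\<theta> * blinfun_apply v (blinfun_apply A u) \<le> \<theta> / \<tau> * ((norm u)\<^sup>2 / 2) + 1 / \<sigma> * ((norm v)\<^sup>2 / 2)"
proof -
  let ?N = "norm A"
  \<comment> \<open>This form of \<open>step_size\<close> gives exactly the required coefficients
    when the square of \<open>\<sigma> * \<theta> * ?N * norm u - norm v\<close> is
    expanded.\<close>
  have eq: "(\<sigma> * \<theta> * ?N)\<^sup>2 = \<sigma> * \<theta> / \<tau>"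
  proof -
    have "(\<sigma> * \<theta> * ?N)\<^sup>2 * \<tau> = \<sigma> * \<theta> * (\<theta> * \<sigma> * \<tau> * ?N\<^sup>2)" by (simp add: power2_eq_square)
    then show ?thesis using \<tau> unfolding step_size by (simp add: eq_divide_eq)
  qed
  have "0 \<le> (\<sigma> * \<theta> * ?N * norm u - norm v)\<^sup>2" by simp
  also have "\<dots> = (\<sigma> * \<theta> * ?N)\<^sup>2 * (norm u)\<^sup>2 + (norm v)\<^sup>2 - 2 * \<sigma> * (\<theta> * (?N * norm u * norm v))"
    by (simp add: power2_eq_square algebra_simps)
  finally have "2 * \<sigma> * (\<theta> * (?N * norm u * norm v)) \<le> \<sigma> * \<theta> / \<tau> * (norm u)\<^sup>2 + (norm v)\<^sup>2"
    by (simp add: eq)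
  then have "\<theta> * (?N * norm u * norm v) \<le> (\<sigma> * \<theta> / \<tau> * (norm u)\<^sup>2 + (norm v)\<^sup>2) / (2 * \<sigma>)"
    using \<sigma> by (simp add: pos_le_divide_eq mult_ac)
  also have "\<dots> = \<theta> / \<tau> * ((norm u)\<^sup>2 / 2) + 1 / \<sigma> * ((norm v)\<^sup>2 / 2)"
    using \<sigma> \<tau> by (simp add: field_simps)
  finally show ?thesis
    using mult_left_mono[OF pairing_le[of v u], of \<theta>] \<theta> by linarith
qed

text \<open>Used twice: with \<open>v = y (Suc k)\<close> it absorbs the extrapolation error in
  \<open>one_step\<close>, and with general \<open>v\<close> it shows that all of
  \<open>Lyap\<close> beyond its first term is nonnegative.\<close>

lemma young_bregman:
  assumes "v \<in> V"
  shows "\<theta> * blinfun_apply (v - y k) (blinfun_apply A (x k - x (k - 1)))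
    \<le> \<theta> / \<tau> * DX (x k) (x (k - 1)) + 1 / \<sigma> * DY v (y k)"
proof -
  have "\<theta> / \<tau> * ((norm (x k - x (k - 1)))\<^sup>2 / 2) \<le> \<theta> / \<tau> * DX (x k) (x (k - 1))"
    using DX[OF x] \<theta> \<tau> by (intro mult_left_mono) auto
  moreover have "1 / \<sigma> * ((norm (v - y k))\<^sup>2 / 2) \<le> 1 / \<sigma> * DY v (y k)"
    using DY[OF assms] \<sigma> by (intro mult_left_mono) auto
  ultimately show ?thesis using young[of "v - y k" "x k - x (k - 1)"] by linarith
qed

text \<open>Adding the two three-point inequalities leaves the pairing of
  \<open>y (Suc k) - y k\<close> with \<open>\<theta> A (x k - x (k - 1))\<close>. By
  \<open>young_bregman\<close> it costs \<open>DY (y (Suc k)) (y k) / \<sigma>\<close>, which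
  \<open>y_step\<close> supplies, and a \<open>DX\<close> term contained in
  \<open>Lyap k u v\<close>.\<close>

lemma one_step:
  assumes u: "u \<in> C" and v: "v \<in> V"
  shows "Lag (x (Suc k)) v - Lag u (y (Suc k)) \<le> Lyap k u v - Lyap (Suc k) u v / \<theta>"
proof -
  let ?A = "blinfun_apply A"
  have "Lyap (Suc k) u v / \<theta> = 1 / \<tau> / \<theta> * DX u (x (Suc k)) + 1 / \<sigma> / \<theta> * DY v (y (Suc k))
      + 1 / \<tau> * DX (x (Suc k)) (x k) - blinfun_apply (v - y (Suc k)) (?A (x (Suc k) - x k))"
    using \<theta> by (simp add: Lyap_def field_simps)
  then show ?thesis
    using x_step[OF u, of k] y_step[OF v, of k] young_bregman[OF y[of "Suc k"], of k]
    unfolding Lag_def Lyap_def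
    by (simp add: blinfun.diff_left blinfun.diff_right blinfun.add_right blinfun.scaleR_right algebra_simps)
qed

lemma telescoped:
  assumes u: "u \<in> C" and v: "v \<in> V"
  shows "(\<Sum>k=1..K. 1 / \<theta> ^ (k - 1) * (Lag (x k) v - Lag u (y k)))
    \<le> Lyap 0 u v - 1 / \<theta> ^ K * Lyap K u v"
proof (induction K)
  case (Suc K)
  have "1 / \<theta> ^ K * (Lag (x (Suc K)) v - Lag u (y (Suc K)))
      \<le> 1 / \<theta> ^ K * (Lyap K u v - Lyap (Suc K) u v / \<theta>)"
    using \<theta> by (intro mult_left_mono one_step u v) auto
  also have "\<dots> = 1 / \<theta> ^ K * Lyap K u v - 1 / \<theta> ^ Suc K * Lyap (Suc K) u v"
    using \<theta> by (simp add: field_simps)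
  finally show ?case using Suc by simp
qed simp

section \<open>Weighted averages of the iterates\<close>

definition Tw :: "nat \<Rightarrow> real" where "Tw K = (\<Sum>k=1..K. 1 / \<theta> ^ (k - 1))"
definition Xav :: "nat \<Rightarrow> 'x" where "Xav K = (1 / Tw K) *\<^sub>R (\<Sum>k=1..K. (1 / \<theta> ^ (k - 1)) *\<^sub>R x k)"
definition Yav :: "nat \<Rightarrow> ('y \<Rightarrow>\<^sub>L real)" where
  "Yav K = (1 / Tw K) *\<^sub>R (\<Sum>k=1..K. (1 / \<theta> ^ (k - 1)) *\<^sub>R y k)"

lemma Tw_closed_form:
  assumes "K \<ge> 1"
  shows "Tw K = (1 - \<theta> ^ K) / ((1 - \<theta>) * \<theta> ^ (K - 1))"
  using assms
proof (induction K rule: dec_induct)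
  case base
  show ?case using \<theta> by (simp add: Tw_def)
next
  case (step K)
  then obtain m where m: "K = Suc m" by (cases K) auto
  have "Tw (Suc K) = Tw K + 1 / \<theta> ^ K" by (simp add: Tw_def)
  also have "\<dots> = (1 - \<theta> ^ Suc K) / ((1 - \<theta>) * \<theta> ^ K)"
    unfolding step.IH using \<theta> by (simp add: m divide_simps) (simp add: algebra_simps)
  finally show ?case by simp
qed

text \<open>Every weight is at least \<open>1\<close> because \<open>\<theta> < 1\<close>. This
  yields both positivity of \<open>Tw K\<close> for \<open>K \<ge> 1\<close> and divergence.\<close>

lemma Tw_ge: "real K \<le> Tw K"
proof -
  have "(\<Sum>k=1..K. 1) \<le> Tw K"
    unfolding Tw_def using \<theta> by (intro sum_mono) (simp add: power_le_one)
  then show ?thesis by simp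
qed

lemma average_jensen:
  fixes F :: "'b::real_vector \<Rightarrow> real"
  assumes F: "convex_on S F" and z: "\<And>k. z k \<in> S" and K: "K \<ge> 1"
  shows "(1 / Tw K) *\<^sub>R (\<Sum>k=1..K. (1 / \<theta> ^ (k - 1)) *\<^sub>R z k) \<in> S"
    and "Tw K * F ((1 / Tw K) *\<^sub>R (\<Sum>k=1..K. (1 / \<theta> ^ (k - 1)) *\<^sub>R z k))
      \<le> (\<Sum>k=1..K. 1 / \<theta> ^ (k - 1) * F (z k))"
proof -
  let ?a = "\<lambda>k. 1 / \<theta> ^ (k - 1) / Tw K"
  have T: "Tw K > 0" using Tw_ge[of K] K by simp
  have eq: "(1 / Tw K) *\<^sub>R (\<Sum>k=1..K. (1 / \<theta> ^ (k - 1)) *\<^sub>R z k) = (\<Sum>k=1..K. ?a k *\<^sub>R z k)"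
    by (simp add: scaleR_sum_right mult.commute)
  have one: "(\<Sum>k=1..K. ?a k) = 1"
    using T by (simp only: sum_divide_distrib[symmetric] Tw_def[symmetric]) simp
  have pos: "0 \<le> ?a k" for k using \<theta> T by simp
  show "(1 / Tw K) *\<^sub>R (\<Sum>k=1..K. (1 / \<theta> ^ (k - 1)) *\<^sub>R z k) \<in> S"
    unfolding eq using convex_on_imp_convex[OF F] one pos z
    by (intro convex_sum) auto
  have "F (\<Sum>k=1..K. ?a k *\<^sub>R z k) \<le> (\<Sum>k=1..K. ?a k * F (z k))"
    using K one pos z by (intro convex_on_sum[OF _ _ F]) auto
  also have "\<dots> = (\<Sum>k=1..K. 1 / \<theta> ^ (k - 1) * F (z k)) / Tw K"
    by (simp add: sum_divide_distrib)
  finally show "Tw K * F ((1 / Tw K) *\<^sub>R (\<Sum>k=1..K. (1 / \<theta> ^ (k - 1)) *\<^sub>R z k))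
      \<le> (\<Sum>k=1..K. 1 / \<theta> ^ (k - 1) * F (z k))"
    unfolding eq using T by (simp add: pos_le_divide_eq mult.commute)
qed

lemma Xav_in: "K \<ge> 1 \<Longrightarrow> Xav K \<in> C" and Yav_in: "K \<ge> 1 \<Longrightarrow> Yav K \<in> V"
  unfolding Xav_def Yav_def by (rule average_jensen(1)[where z = x, OF G x] average_jensen(1)[where z = y, OF H y]; assumption)+

lemma ergodic:
  assumes u: "u \<in> C" and v: "v \<in> V" and K: "K \<ge> 1"
  shows "Tw K * (Lag (Xav K) v - Lag u (Yav K)) \<le> Lyap 0 u v - 1 / \<theta> ^ K * Lyap K u v"
proof -
  \<comment> \<open>Up to constants, \<open>cx\<close> and \<open>cy\<close> concern
    \<open>Lag\<close> in its first argument and \<open>- Lag\<close> in its second. Jensen applies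
    to each separately, and the constants are carried with total weight \<open>Tw K\<close>.\<close>
  have cx: "convex_on C (\<lambda>z. G z + blinfun_apply v (blinfun_apply A z))"
    using convex_on_imp_convex[OF G]
    by (intro convex_on_add[OF G] convex_onI) (simp_all add: blinfun.add_right blinfun.scaleR_right)
  have cy: "convex_on V (\<lambda>z. H z + - blinfun_apply z (blinfun_apply A u))"
    using convex_on_imp_convex[OF H]
    by (intro convex_on_add[OF H] convex_onI)
      (simp_all add: blinfun.add_left blinfun.diff_left blinfun.scaleR_left algebra_simps)
  have T: "Tw K = (\<Sum>k=1..K. 1 / \<theta> ^ (k - 1))" by (rule Tw_def)
  have "Tw K * (Lag (Xav K) v - Lag u (Yav K))
      = Tw K * (G (Xav K) + blinfun_apply v (blinfun_apply A (Xav K)))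
        + Tw K * (H (Yav K) + - blinfun_apply (Yav K) (blinfun_apply A u)) - Tw K * (H v + G u)"
    by (simp add: Lag_def algebra_simps)
  also have "\<dots> \<le> (\<Sum>k=1..K. 1 / \<theta> ^ (k - 1) * (G (x k) + blinfun_apply v (blinfun_apply A (x k))))
        + (\<Sum>k=1..K. 1 / \<theta> ^ (k - 1) * (H (y k) + - blinfun_apply (y k) (blinfun_apply A u)))
        - Tw K * (H v + G u)"
    using average_jensen(2)[where z = x, OF cx x K] average_jensen(2)[where z = y, OF cy y K]
    unfolding Xav_def Yav_def by linarith
  also have "\<dots> = (\<Sum>k=1..K. 1 / \<theta> ^ (k - 1) * (Lag (x k) v - Lag u (y k)))"
    unfolding T sum_distrib_right sum.distrib[symmetric] sum_subtractf[symmetric]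
    by (rule sum.cong) (simp_all add: Lag_def algebra_simps add_divide_distrib)
  also note telescoped[OF u v]
  finally show ?thesis .
qed

lemma bregman_le_Lyap:
  assumes "v \<in> V"
  shows "1 / \<tau> * DX u (x k) \<le> Lyap k u v"
  using young_bregman[OF assms, of k] by (simp add: Lyap_def)

section \<open>Convergence to a saddle point\<close>

context
  fixes xs :: 'x and ys :: "'y \<Rightarrow>\<^sub>L real"
  assumes xs: "xs \<in> C" and ys: "ys \<in> V"
    and saddle: "\<And>u v. u \<in> C \<Longrightarrow> v \<in> V \<Longrightarrow> Lag xs v \<le> Lag u ys"
begin

lemma Lyap_decay: "Lyap K xs ys \<le> \<theta> ^ K * Lyap 0 xs ys"
proof (induction K)
  case (Suc K)
  have "Lyap (Suc K) xs ys / \<theta> \<le> Lyap K xs ys"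
    using one_step[OF xs ys, of K] saddle[OF x[of "Suc K"] y[of "Suc K"]] by linarith
  then have "Lyap (Suc K) xs ys \<le> \<theta> * Lyap K xs ys" using \<theta> by (simp add: field_simps)
  also have "\<dots> \<le> \<theta> * (\<theta> ^ K * Lyap 0 xs ys)" using Suc \<theta> by simp
  finally show ?case by simp
qed simp

lemma Lyap_bound_tendsto: "(\<lambda>K. c * (\<theta> ^ K * Lyap 0 xs ys)) \<longlonglongrightarrow> 0"
proof -
  have "(\<lambda>K. c * (\<theta> ^ K * Lyap 0 xs ys)) \<longlonglongrightarrow> c * (0 * Lyap 0 xs ys)"
    using \<theta> by (intro tendsto_intros LIMSEQ_realpow_zero) auto
  then show ?thesis by simp
qed

lemma x_tendsto: "x \<longlonglongrightarrow> xs"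
proof (rule tendsto_of_sq_norm[OF _ Lyap_bound_tendsto])
  fix k
  have "(norm (xs - x k))\<^sup>2 / 2 \<le> \<tau> * (1 / \<tau> * DX xs (x k))" using DX[OF xs] \<tau> by simp
  also have "\<dots> \<le> \<tau> * (\<theta> ^ k * Lyap 0 xs ys)"
    using bregman_le_Lyap[OF ys, of xs k] Lyap_decay[of k] \<tau> by (intro mult_left_mono) auto
  finally show "(norm (xs - x k))\<^sup>2 \<le> (2 * \<tau>) * (\<theta> ^ k * Lyap 0 xs ys)" by simp
qed

text \<open>Bounding \<open>Lyap\<close> as in \<open>bregman_le_Lyap\<close> spends the whole
  \<open>DY\<close> term on the pairing, so nothing is left to control \<open>y\<close>. Instead,
  convergence of \<open>x\<close> makes \<open>x k - x (k - 1)\<close> vanish, and the pairing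
  becomes a vanishing multiple of \<open>norm (ys - y k)\<close>.\<close>

lemma y_tendsto: "y \<longlonglongrightarrow> ys"
proof (rule tendsto_of_sq_norm)
  define d where "d = (\<lambda>k. norm (x k - x (k - 1)))"
  define N where "N = norm A"
  have "(\<lambda>k. x (k - 1)) \<longlonglongrightarrow> xs" by (rule LIMSEQ_offset[where k=1]) (simp add: x_tendsto)
  then have "(\<lambda>k. x k - x (k - 1)) \<longlonglongrightarrow> xs - xs" by (rule tendsto_diff[OF x_tendsto])
  then have d0: "d \<longlonglongrightarrow> 0" unfolding d_def by (auto intro: tendsto_norm_zero)
  have "(\<lambda>k. (4 * \<sigma>) * (\<theta> ^ k * Lyap 0 xs ys) + 4 * (\<sigma> * \<theta> * N * d k)\<^sup>2)
      \<longlonglongrightarrow> 0 + 4 * (\<sigma> * \<theta> * N * 0)\<^sup>2"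
    by (intro tendsto_intros Lyap_bound_tendsto d0)
  then show "(\<lambda>k. (4 * \<sigma>) * (\<theta> ^ k * Lyap 0 xs ys) + 4 * (\<sigma> * \<theta> * N * d k)\<^sup>2) \<longlonglongrightarrow> 0" by simp
  fix k
  define b where "b = norm (ys - y k)"
  have "0 \<le> 1 / \<tau> * DX xs (x k)" "0 \<le> \<theta> / \<tau> * DX (x k) (x (k - 1))"
    using order_trans[OF _ DX[OF xs]] order_trans[OF _ DX[OF x]] \<theta> \<tau> by auto
  then have "1 / \<sigma> * DY ys (y k)
      - \<theta> * blinfun_apply (ys - y k) (blinfun_apply A (x k - x (k - 1))) \<le> \<theta> ^ k * Lyap 0 xs ys"
    using Lyap_decay[of k] unfolding Lyap_def[of k] by linarith
  moreover have "\<theta> * blinfun_apply (ys - y k) (blinfun_apply A (x k - x (k - 1))) \<le> \<theta> * (N * d k * b)"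
    unfolding N_def d_def b_def using \<theta> by (intro mult_left_mono pairing_le) auto
  moreover have "1 / \<sigma> * (b\<^sup>2 / 2) \<le> 1 / \<sigma> * DY ys (y k)"
    unfolding b_def using DY[OF ys] \<sigma> by (intro mult_left_mono) auto
  ultimately have "1 / \<sigma> * (b\<^sup>2 / 2) - \<theta> * (N * d k * b) \<le> \<theta> ^ k * Lyap 0 xs ys" by linarith
  then have "(4 * \<sigma>) * (1 / \<sigma> * (b\<^sup>2 / 2) - \<theta> * (N * d k * b)) \<le> (4 * \<sigma>) * (\<theta> ^ k * Lyap 0 xs ys)"
    using \<sigma> by (intro mult_left_mono) auto
  \<comment> \<open>Completing the square with only one of the two copies of
    \<open>b\<^sup>2\<close> keeps the other as the quantity to be bounded.\<close>
  moreover have "(4 * \<sigma>) * (1 / \<sigma> * (b\<^sup>2 / 2) - \<theta> * (N * d k * b))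
      = b\<^sup>2 + (b - 2 * (\<sigma> * \<theta> * N * d k))\<^sup>2 - 4 * (\<sigma> * \<theta> * N * d k)\<^sup>2"
    using \<sigma> by (simp add: power2_eq_square algebra_simps)
  ultimately show "(norm (ys - y k))\<^sup>2 \<le> (4 * \<sigma>) * (\<theta> ^ k * Lyap 0 xs ys) + 4 * (\<sigma> * \<theta> * N * d k)\<^sup>2"
    using zero_le_power2[of "b - 2 * (\<sigma> * \<theta> * N * d k)"] unfolding b_def[symmetric] by linarith
qed

lemma average_tendsto: "Xav \<longlonglongrightarrow> xs" "Yav \<longlonglongrightarrow> ys"
proof -
  have "filterlim Tw at_top sequentially"
    by (rule filterlim_at_top_mono[OF filterlim_real_sequentially]) (simp add: Tw_ge)
  then have T: "filterlim (\<lambda>K. \<Sum>k=1..K. 1 / \<theta> ^ (k - 1)) at_top sequentially"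
    by (simp add: Tw_def[abs_def])
  show "Xav \<longlonglongrightarrow> xs" "Yav \<longlonglongrightarrow> ys"
    unfolding Xav_def[abs_def] Yav_def[abs_def] Tw_def
    using \<theta> by (intro weighted_average_tendsto T x_tendsto y_tendsto; simp)+
qed

end

end

section \<open>Transfer of the real-valued estimates to extended-real functions\<close>

theorem proposition4p4:
  fixes g :: "'x::banach \<Rightarrow> ereal"
    and h :: "'y::banach \<Rightarrow> ereal"
    and A :: "'x \<Rightarrow>\<^sub>L 'y"
    and \<phi>X :: "'x \<Rightarrow> ereal"
    and \<phi>Y :: "('y \<Rightarrow>\<^sub>L real) \<Rightarrow> ereal"
    and \<gamma>g \<gamma>h \<theta> \<tau> \<sigma> :: real
    and x :: "nat \<Rightarrow> 'x"
    and y :: "nat \<Rightarrow> ('y \<Rightarrow>\<^sub>L real)"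
    and xs :: 'x
    and ys :: "'y \<Rightarrow>\<^sub>L real"
    and T :: "nat \<Rightarrow> real"
    and X :: "nat \<Rightarrow> 'x"
    and Y :: "nat \<Rightarrow> ('y \<Rightarrow>\<^sub>L real)"
    and \<Delta> :: "nat \<Rightarrow> 'x \<Rightarrow> ('y \<Rightarrow>\<^sub>L real) \<Rightarrow> ereal"
  assumes reflexive: "reflexive_space TYPE('x)" "reflexive_space TYPE('y)"
    and A_nonzero: "A \<noteq> 0"  \<comment> \<open>implicit in the formula for \<open>\<theta>\<close>, which divides by \<open>norm A\<close>\<close>
    and A1: "g \<in> Gamma0" "h \<in> Gamma0"
      "\<exists>u. is_arg_min (\<lambda>u. g u + h (blinfun_apply A u)) (\<lambda>_. True) u"
      "\<exists>u \<in> edom g. blinfun_apply A u \<in> edom h \<and> isCont h (blinfun_apply A u)"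
    and A2: "\<phi>X \<in> Gamma0" "\<phi>Y \<in> Gamma0"
      "essentially_smooth \<phi>X" "essentially_strictly_convex \<phi>X"
      "essentially_smooth \<phi>Y" "essentially_strictly_convex \<phi>Y"
    and A3: "dom_subdiff g \<subseteq> interior (edom \<phi>X)"
      "supercoercive g \<or> supercoercive \<phi>X"
    and A4: "dom_subdiff (conjugate h) \<subseteq> interior (edom \<phi>Y)"
      "supercoercive (conjugate h) \<or> supercoercive \<phi>Y"
    and A5: "strongly_convex 1 \<phi>X" "strongly_convex 1 \<phi>Y"
    and A6: "\<gamma>g > 0" "econvex (\<lambda>u. g u - ereal \<gamma>g * \<phi>X u)"
    and A7: "\<gamma>h > 0" "econvex (\<lambda>v. conjugate h v - ereal \<gamma>h * \<phi>Y v)"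
    and \<theta>_eq: "\<theta> = 1 - \<gamma>g * \<gamma>h / (2 * (norm A)\<^sup>2)
                      * (sqrt (1 + 4 * (norm A)\<^sup>2 / (\<gamma>g * \<gamma>h)) - 1)"
    and \<tau>_eq: "\<tau> = (1 - \<theta>) / (\<gamma>g * \<theta>)"
    and \<sigma>_eq: "\<sigma> = (1 - \<theta>) / (\<gamma>h * \<theta>)"
    and init: "x 0 \<in> dom_subdiff g" "y 0 \<in> dom_subdiff (conjugate h)"
    and saddle: "saddle_point (lagrangian g h A) xs ys"
    \<comment> \<open>Below, \<open>0 - 1 = 0\<close> on \<open>nat\<close>, so that \<open>x (k - 1)\<close> for \<open>k = 0\<close> is \<open>x 0\<close>, encoding \<open>x\<^sub>-\<^sub>1 = x\<^sub>0\<close>.\<close>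
    and y_step: "\<And>k. is_arg_max
        (\<lambda>v. - conjugate h v
              + ereal (blinfun_apply v (blinfun_apply A (x k + \<theta> *\<^sub>R (x k - x (k - 1)))))
              - ereal (1 / \<sigma>) * bregman \<phi>Y v (y k))
        (\<lambda>_. True) (y (Suc k))"
    and x_step: "\<And>k. is_arg_min
        (\<lambda>u. g u + ereal (blinfun_apply (y (Suc k)) (blinfun_apply A u))
              + ereal (1 / \<tau>) * bregman \<phi>X u (x k))
        (\<lambda>_. True) (x (Suc k))"
    and T_eq: "\<And>K. T K = (\<Sum>k=1..K. 1 / \<theta> ^ (k - 1))"
    and X_eq: "\<And>K. X K = (1 / T K) *\<^sub>R (\<Sum>k=1..K. (1 / \<theta> ^ (k - 1)) *\<^sub>R x k)"
    and Y_eq: "\<And>K. Y K = (1 / T K) *\<^sub>R (\<Sum>k=1..K. (1 / \<theta> ^ (k - 1)) *\<^sub>R y k)"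
    and \<Delta>_eq: "\<And>k u v. \<Delta> k u v =
        ereal (1 / \<tau>) * bregman \<phi>X u (x k) + ereal (1 / \<sigma>) * bregman \<phi>Y v (y k)
        + ereal (\<theta> / \<tau>) * bregman \<phi>X (x k) (x (k - 1))
        - ereal (\<theta> * blinfun_apply (v - y k) (blinfun_apply A (x k - x (k - 1))))"
  shows
    "(\<forall>K\<ge>1. T K = (1 - \<theta> ^ K) / ((1 - \<theta>) * \<theta> ^ (K - 1)))
     \<and> (\<forall>u \<in> edom g. \<forall>v \<in> edom (conjugate h). \<forall>k.
          lagrangian g h A (x (Suc k)) v - lagrangian g h A u (y (Suc k))
            \<le> \<Delta> k u v - \<Delta> (Suc k) u v / ereal \<theta>)
     \<and> (\<forall>u \<in> edom g. \<forall>v \<in> edom (conjugate h). \<forall>K\<ge>1.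
          ereal (T K) * (lagrangian g h A (X K) v - lagrangian g h A u (Y K))
            \<le> \<Delta> 0 u v - ereal (1 / \<theta> ^ K) * \<Delta> K u v)
     \<and> (\<forall>K. ereal (1 / \<tau>) * bregman \<phi>X xs (x K) \<le> \<Delta> K xs ys
             \<and> \<Delta> K xs ys \<le> ereal (\<theta> ^ K) * \<Delta> 0 xs ys)
     \<and> (\<lambda>k. (x k, y k)) \<longlonglongrightarrow> (xs, ys)
     \<and> (\<lambda>K. (X K, Y K)) \<longlonglongrightarrow> (xs, ys)"
proof -
  let ?H = "conjugate h"
  let ?g = "\<lambda>u. real_of_ereal (g u)" and ?h = "\<lambda>v. real_of_ereal (conjugate h v)"
  have pg: "proper_fun g" and cg: "econvex g" and ph: "proper_fun h"
    and pX: "proper_fun \<phi>X" and cX: "econvex \<phi>X" and pY: "proper_fun \<phi>Y" and cY: "econvex \<phi>Y"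
    using A1 A2 by (auto simp: Gamma0_def)
  have x0: "x 0 \<in> edom g" and y0: "y 0 \<in> edom ?H"
    using init by (auto simp: dom_subdiff_def subdiff_def)
  have x0i: "x 0 \<in> interior (edom \<phi>X)" and y0i: "y 0 \<in> interior (edom \<phi>Y)"
    using init A3(1) A4(1) by blast+
  have pH: "proper_fun ?H" using proper_conjugate[OF ph] y0 by blast
  have cH: "econvex ?H" by (rule econvex_conjugate[OF ph])
  \<comment> \<open>The rate depends on the data through \<open>s\<close> alone, and
    \<open>rate_equation\<close> turns into the step-size identity below.\<close>
  define s where "s = \<gamma>g * \<gamma>h / (norm A)\<^sup>2"
  have nA: "norm A > 0" using A_nonzero by simp
  have s: "s > 0" using nA A6(1) A7(1) by (simp add: s_def)
  have "\<theta> = 1 - s / 2 * (sqrt (1 + 4 / s) - 1)"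
    using \<theta>_eq by (simp add: s_def mult.commute)
  note rate = rate_equation[OF s this]
  have \<tau>: "\<tau> > 0" and \<sigma>: "\<sigma> > 0" using rate A6(1) A7(1) by (auto simp: \<tau>_eq \<sigma>_eq)
  have step: "\<theta> * \<sigma> * \<tau> * (norm A)\<^sup>2 = 1"
  proof -
    have "\<theta> * \<sigma> * \<tau> * (norm A)\<^sup>2 = (1 - \<theta>)\<^sup>2 / (s * \<theta>)"
      using rate A6(1) A7(1) nA by (simp add: \<tau>_eq \<sigma>_eq s_def power2_eq_square)
    then show ?thesis using rate s by simp
  qed
  \<comment> \<open>Both sides of the first equation equal
    \<open>\<gamma>g / (1 - \<theta>)\<close>, and both sides of the second
    \<open>\<gamma>h / (1 - \<theta>)\<close>.\<close>
  have inv\<tau>: "1 / \<tau> + \<gamma>g = 1 / \<tau> / \<theta>" and inv\<sigma>: "1 / \<sigma> + \<gamma>h = 1 / \<sigma> / \<theta>"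
    using rate A6(1) A7(1) by (simp_all add: \<tau>_eq \<sigma>_eq field_simps)
  let ?l = "\<lambda>k u. blinfun_apply (y (Suc k)) (blinfun_apply A u)"
  let ?m = "\<lambda>k v. - blinfun_apply v (blinfun_apply A (x k + \<theta> *\<^sub>R (x k - x (k - 1))))"
  have proxX: "bregman_prox \<phi>X g \<gamma>g (1 / \<tau>) (x 0) (x k) (?l k) (x (Suc k))"
    if "x k \<in> interior (edom \<phi>X)" for k
    using that x_step[of k] A2 pg cg A6 x0 x0i \<tau>
    by unfold_locales (auto simp: linear_iff blinfun.add_right blinfun.scaleR_right)
  have y_min: "is_arg_min (\<lambda>v. ?H v + ereal (?m k v) + ereal (1 / \<sigma>) * bregman \<phi>Y v (y k))
      (\<lambda>_. True) (y (Suc k))" if yk: "y k \<in> interior (edom \<phi>Y)" for k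
  proof -
    let ?F = "\<lambda>v. ?H v + ereal (?m k v) + ereal (1 / \<sigma>) * bregman \<phi>Y v (y k)"
    \<comment> \<open>Negation distributes over these sums because opposite infinities never meet:
      \<open>?H\<close> and \<open>\<phi>Y\<close> avoid \<open>- \<infinity>\<close>, and
      \<open>\<phi>Y (y k)\<close> is finite.\<close>
    have neg: "- ?H v + ereal (- ?m k v) - ereal (1 / \<sigma>) * bregman \<phi>Y v (y k) = - ?F v" for v
    proof -
      obtain b where b: "\<phi>Y (y k) = ereal b"
        using yk interior_subset edom_iff_ereal[OF pY] by blast
      have "- \<infinity> < ?H v" "- \<infinity> < \<phi>Y v" using pH pY by (auto simp: proper_fun_def)
      then show ?thesis
        using \<sigma> by (cases "?H v"; cases "\<phi>Y v") (auto simp: bregman_def b)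
    qed
    have "is_arg_max (\<lambda>v. - ?F v) (\<lambda>_. True) (y (Suc k))"
      using y_step[of k] unfolding neg[symmetric] by simp
    then show ?thesis by (simp add: is_arg_max_def is_arg_min_def)
  qed
  have proxY: "bregman_prox \<phi>Y ?H \<gamma>h (1 / \<sigma>) (y 0) (y k) (?m k) (y (Suc k))"
    if "y k \<in> interior (edom \<phi>Y)" for k
    using that y_min[OF that] A2 pH cH A7 y0 y0i \<sigma>
    by unfold_locales (auto simp: linear_iff blinfun.add_left blinfun.scaleR_left)
  \<comment> \<open>The proximal step needs its centre in the interior and returns a minimiser
    there, so the property propagates by induction.\<close>
  have xk: "x k \<in> edom g \<and> x k \<in> interior (edom \<phi>X)" for k
  proof (induction k)
    case (Suc k)
    interpret bregman_prox \<phi>X g \<gamma>g "1 / \<tau>" "x 0" "x k" "?l k" "x (Suc k)"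
      using proxX Suc by blast
    show ?case using minimiser_edom minimiser_interior by blast
  qed (use x0 x0i in blast)
  have yk: "y k \<in> edom ?H \<and> y k \<in> interior (edom \<phi>Y)" for k
  proof (induction k)
    case (Suc k)
    interpret bregman_prox \<phi>Y ?H \<gamma>h "1 / \<sigma>" "y 0" "y k" "?m k" "y (Suc k)"
      using proxY Suc by blast
    show ?case using minimiser_edom minimiser_interior by blast
  qed (use y0 y0i in blast)
  have subX: "edom g \<subseteq> edom \<phi>X" by (rule edom_subset_of_relative_convex[OF pX pg A6(2,1) x0 x0i])
  have subY: "edom ?H \<subseteq> edom \<phi>Y" by (rule edom_subset_of_relative_convex[OF pY pH A7(2,1) y0 y0i])
  interpret primal_dual_iteration A "edom g" "edom ?H" ?g ?h "rbregman \<phi>X" "rbregman \<phi>Y" \<theta> \<tau> \<sigma> x y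
  proof
    show "convex_on (edom g) ?g" "convex_on (edom ?H) ?h"
      by (rule econvex_imp_convex_on[OF pg cg] econvex_imp_convex_on[OF pH cH])+
    show "0 < \<theta>" "\<theta> < 1" "0 < \<tau>" "0 < \<sigma>" "\<theta> * \<sigma> * \<tau> * (norm A)\<^sup>2 = 1"
      using rate \<tau> \<sigma> step by auto
    show "x k \<in> edom g" "y k \<in> edom ?H" for k using xk yk by auto
    show "(norm (u - x k))\<^sup>2 / 2 \<le> rbregman \<phi>X u (x k)" if "u \<in> edom g" for u k
    proof -
      obtain q where "has_gradient \<phi>X q (x k)"
        using A2(3) xk[of k] unfolding essentially_smooth_def by blast
      then show ?thesis using rbregman_ge[OF pX A5(1)] that subX xk[of k] by fastforce
    qed
    show "(norm (v - y k))\<^sup>2 / 2 \<le> rbregman \<phi>Y v (y k)" if "v \<in> edom ?H" for v k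
    proof -
      obtain q where "has_gradient \<phi>Y q (y k)"
        using A2(5) yk[of k] unfolding essentially_smooth_def by blast
      then show ?thesis using rbregman_ge[OF pY A5(2)] that subY yk[of k] by fastforce
    qed
    show "?g (x (Suc k)) + blinfun_apply (y (Suc k)) (blinfun_apply A (x (Suc k)))
        + 1 / \<tau> * rbregman \<phi>X (x (Suc k)) (x k) + 1 / \<tau> / \<theta> * rbregman \<phi>X u (x (Suc k))
      \<le> ?g u + blinfun_apply (y (Suc k)) (blinfun_apply A u) + 1 / \<tau> * rbregman \<phi>X u (x k)"
      if "u \<in> edom g" for u k
      using bregman_prox.three_point[OF proxX that, of k] xk[of k] unfolding inv\<tau> by blast
    show "?h (y (Suc k)) - blinfun_apply (y (Suc k)) (blinfun_apply A (x k + \<theta> *\<^sub>R (x k - x (k - 1))))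
        + 1 / \<sigma> * rbregman \<phi>Y (y (Suc k)) (y k) + 1 / \<sigma> / \<theta> * rbregman \<phi>Y v (y (Suc k))
      \<le> ?h v - blinfun_apply v (blinfun_apply A (x k + \<theta> *\<^sub>R (x k - x (k - 1)))) + 1 / \<sigma> * rbregman \<phi>Y v (y k)"
      if "v \<in> edom ?H" for v k
      using bregman_prox.three_point[OF proxY that, of k] yk[of k] unfolding inv\<sigma> diff_conv_add_uminus by blast
  qed
  have Tw: "T K = Tw K" and Xav: "X K = Xav K" and Yav: "Y K = Yav K" for K
    by (simp_all add: T_eq X_eq Y_eq Tw_def Xav_def Yav_def)
  have bX: "bregman \<phi>X u (x k) = ereal (rbregman \<phi>X u (x k))" if "u \<in> edom g" for u k
    using bregman_eq_rbregman[OF pX] subX that xk[of k] by blast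
  have bY: "bregman \<phi>Y v (y k) = ereal (rbregman \<phi>Y v (y k))" if "v \<in> edom ?H" for v k
    using bregman_eq_rbregman[OF pY] subY that yk[of k] by blast
  have \<Delta>: "\<Delta> k u v = ereal (Lyap k u v)" if "u \<in> edom g" "v \<in> edom ?H" for k u v
    using that xk by (simp add: \<Delta>_eq Lyap_def bX bY)
  have L: "lagrangian g h A u v = ereal (Lag u v)" if uv: "u \<in> edom g" "v \<in> edom ?H" for u v
  proof -
    obtain a b where "g u = ereal a" "?H v = ereal b"
      using uv edom_iff_ereal[OF pg] edom_iff_ereal[OF pH] by blast
    then show ?thesis by (simp add: lagrangian_def Lag_def)
  qed
  have sadL: "lagrangian g h A xs v \<le> lagrangian g h A xs ys"
    and sadR: "lagrangian g h A xs ys \<le> lagrangian g h A u ys" for u v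
    using saddle by (auto simp: saddle_point_def)
  obtain a0 b0 where ab0: "g (x 0) = ereal a0" "?H (y 0) = ereal b0"
    using x0 y0 edom_iff_ereal[OF pg] edom_iff_ereal[OF pH] by blast
  \<comment> \<open>Otherwise the saddle value is \<open>\<infinity>\<close>, whatever
    \<open>?H ys\<close> is, while replacing \<open>xs\<close> by \<open>x 0\<close> gives a value
    below \<open>\<infinity>\<close>. With \<open>g xs\<close> finite, the same comparison with
    \<open>y 0\<close> puts \<open>ys\<close> in \<open>edom ?H\<close>.\<close>
  have xs: "xs \<in> edom g"
  proof (rule ccontr)
    assume "xs \<notin> edom g"
    then have "lagrangian g h A xs ys = \<infinity>" by (simp add: edom_def lagrangian_def)
    moreover have "- \<infinity> < ?H ys" using pH by (simp add: proper_fun_def)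
    then have "lagrangian g h A (x 0) ys < \<infinity>"
      by (cases "?H ys") (auto simp: lagrangian_def ab0)
    ultimately show False using sadR[of "x 0"] by simp
  qed
  then obtain a where a: "g xs = ereal a" using edom_iff_ereal[OF pg] by blast
  have ys: "ys \<in> edom ?H"
  proof (rule ccontr)
    assume "ys \<notin> edom ?H"
    then have "lagrangian g h A xs ys = - \<infinity>" by (simp add: edom_def lagrangian_def a)
    then show False using sadL[of "y 0"] by (simp add: lagrangian_def ab0 a)
  qed
  have sad: "Lag xs v \<le> Lag u ys" if "u \<in> edom g" "v \<in> edom ?H" for u v
    using order_trans[OF sadL[of v] sadR[of u]] that xs ys by (simp add: L)
  show ?thesis
  proof (intro conjI ballI allI impI)
    show "T K = (1 - \<theta> ^ K) / ((1 - \<theta>) * \<theta> ^ (K - 1))" if "1 \<le> K" for K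
      unfolding Tw by (rule Tw_closed_form[OF that])
    show "lagrangian g h A (x (Suc k)) v - lagrangian g h A u (y (Suc k))
        \<le> \<Delta> k u v - \<Delta> (Suc k) u v / ereal \<theta>" if "u \<in> edom g" "v \<in> edom ?H" for u v k
      using one_step[OF that] that xk yk rate(1) by (simp add: L \<Delta>)
    show "ereal (T K) * (lagrangian g h A (X K) v - lagrangian g h A u (Y K))
        \<le> \<Delta> 0 u v - ereal (1 / \<theta> ^ K) * \<Delta> K u v"
      if "u \<in> edom g" "v \<in> edom ?H" "1 \<le> K" for u v K
      using ergodic[OF that] that Xav_in Yav_in by (simp add: L \<Delta> Tw Xav Yav)
    show "ereal (1 / \<tau>) * bregman \<phi>X xs (x K) \<le> \<Delta> K xs ys" for K
      using bregman_le_Lyap[OF ys, of xs K] xs ys by (simp add: bX \<Delta>)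
    show "\<Delta> K xs ys \<le> ereal (\<theta> ^ K) * \<Delta> 0 xs ys" for K
      using Lyap_decay[OF xs ys sad] xs ys by (simp add: \<Delta>)
    show "(\<lambda>k. (x k, y k)) \<longlonglongrightarrow> (xs, ys)"
      using x_tendsto[OF xs ys sad] y_tendsto[OF xs ys sad] by (intro tendsto_Pair) auto
    show "(\<lambda>K. (X K, Y K)) \<longlonglongrightarrow> (xs, ys)"
      using average_tendsto[OF xs ys sad] unfolding Xav Yav by (intro tendsto_Pair) auto
  qed
qed

end
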